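(* Let $q=2^{2n+1}$ with $n$ a positive integer. The maximal subgroup $\mathrm{Sz}(q)$ of $\mathrm{Sp}_4(q)$ is not a strong Gelfand subgroup, i.e. $(\mathrm{Sp}_4(q),\mathrm{Sz}(q))$ is not a strong Gelfand pair.
   Context: All characters are complex. A pair $(G,H)$ with $H\le G$ finite is a strong Gelfand pair (and $H$ a strong Gelfand subgroup) if for every irreducible character $\psi$ of $H$, the induced character $\psi\uparrow G$ satisfies $\langle \psi\uparrow G,\chi\rangle\le 1$ for every irreducible character $\chi$ of $G$. $\mathrm{Sp}_4(q)$ is the symplectic group of a nondegenerate alternating form on $\mathbb{F}_q^4$; $\mathrm{Sz}(q)$ is the Suzuki group of order $q^2(q^2+1)(q-1)$, embedded in $\mathrm{Sp}_4(q)$ as a maximal subgroup when $q$ is an odd power of $2$. *)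

theory Defs
  imports "Jordan_Normal_Form.Matrix" "HOL-Algebra.Generated_Groups"
begin

definition is_rep :: "('g, 'b) monoid_scheme \<Rightarrow> nat \<Rightarrow> ('g \<Rightarrow> complex mat) \<Rightarrow> bool" where
  "is_rep G d \<rho> \<longleftrightarrow>
     (\<forall>g\<in>carrier G. \<rho> g \<in> carrier_mat d d) \<and>
     \<rho> \<one>\<^bsub>G\<^esub> = 1\<^sub>m d \<and>
     (\<forall>g\<in>carrier G. \<forall>h\<in>carrier G. \<rho> (g \<otimes>\<^bsub>G\<^esub> h) = \<rho> g * \<rho> h)"

definition is_subspace_vec :: "nat \<Rightarrow> complex vec set \<Rightarrow> bool" where
  "is_subspace_vec d W \<longleftrightarrow> W \<subseteq> carrier_vec d \<and> 0\<^sub>v d \<in> W \<and>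
     (\<forall>v\<in>W. \<forall>w\<in>W. v + w \<in> W) \<and> (\<forall>c. \<forall>v\<in>W. c \<cdot>\<^sub>v v \<in> W)"

definition is_irr_rep :: "('g, 'b) monoid_scheme \<Rightarrow> nat \<Rightarrow> ('g \<Rightarrow> complex mat) \<Rightarrow> bool" where
  "is_irr_rep G d \<rho> \<longleftrightarrow> is_rep G d \<rho> \<and> d > 0 \<and>
     (\<forall>W. is_subspace_vec d W \<and> (\<forall>g\<in>carrier G. \<forall>w\<in>W. \<rho> g *\<^sub>v w \<in> W)
          \<longrightarrow> W = {0\<^sub>v d} \<or> W = carrier_vec d)"

definition mat_trace :: "complex mat \<Rightarrow> complex" where
  "mat_trace A = (\<Sum>i<dim_row A. A $$ (i, i))"

definition irr_char :: "('g, 'b) monoid_scheme \<Rightarrow> ('g \<Rightarrow> complex) \<Rightarrow> bool" where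
  "irr_char G \<chi> \<longleftrightarrow> (\<exists>d \<rho>. is_irr_rep G d \<rho> \<and> (\<forall>g\<in>carrier G. \<chi> g = mat_trace (\<rho> g)))"

definition char_inner :: "('g, 'b) monoid_scheme \<Rightarrow> ('g \<Rightarrow> complex) \<Rightarrow> ('g \<Rightarrow> complex) \<Rightarrow> complex" where
  "char_inner G \<alpha> \<beta> = (\<Sum>g\<in>carrier G. \<alpha> g * cnj (\<beta> g)) / of_nat (card (carrier G))"

definition induced_char :: "('g, 'b) monoid_scheme \<Rightarrow> 'g set \<Rightarrow> ('g \<Rightarrow> complex) \<Rightarrow> ('g \<Rightarrow> complex)" where
  "induced_char G H \<psi> = (\<lambda>g. (\<Sum>x\<in>carrier G.
      (let y = x \<otimes>\<^bsub>G\<^esub> g \<otimes>\<^bsub>G\<^esub> inv\<^bsub>G\<^esub> x in if y \<in> H then \<psi> y else 0))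
      / of_nat (card H))"

definition strong_gelfand_pair :: "('g, 'b) monoid_scheme \<Rightarrow> 'g set \<Rightarrow> bool" where
  "strong_gelfand_pair G H \<longleftrightarrow>
     (\<forall>\<psi>. irr_char (G\<lparr>carrier := H\<rparr>) \<psi> \<longrightarrow>
        (\<forall>\<chi>. irr_char G \<chi> \<longrightarrow> Re (char_inner G (induced_char G H \<psi>) \<chi>) \<le> 1))"

text \<open>Gram matrix of the alternating form: hyperbolic pairs (e1,e4), (e2,e3).\<close>
definition J4 :: "'a::field mat" where
  "J4 = mat 4 4 (\<lambda>(i,j). if i + j = 3 then (if i < j then 1 else - 1) else 0)"

definition Sp4 :: "'a::field mat monoid" where
  "Sp4 = \<lparr>carrier = {A \<in> carrier_mat 4 4. transpose_mat A * J4 * A = J4},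
          mult = (*), one = 1\<^sub>m 4\<rparr>"

text \<open>Suzuki's generators, for q = 2^(2n+1), theta(x) = x^(2^(n+1)) (so theta^2 = Frobenius).\<close>
definition sz_T :: "nat \<Rightarrow> 'a::field \<Rightarrow> 'a \<Rightarrow> 'a mat" where
  "sz_T n a b = (let t = (\<lambda>x::'a. x ^ (2 ^ (n+1))) in
     mat_of_rows_list 4
      [[1, 0, 0, 0],
       [a, 1, 0, 0],
       [b, t a, 1, 0],
       [a^2 * t a + a * b + t b, a * t a + b, a, 1]])"

definition sz_D :: "nat \<Rightarrow> 'a::field \<Rightarrow> 'a mat" where
  "sz_D n l = mat_of_rows_list 4
      [[l ^ (1 + 2^n), 0, 0, 0],
       [0, l ^ (2^n), 0, 0],
       [0, 0, inverse l ^ (2^n), 0],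
       [0, 0, 0, inverse l ^ (1 + 2^n)]]"

definition sz_W :: "'a::field mat" where
  "sz_W = mat_of_rows_list 4 [[0,0,0,1],[0,0,1,0],[0,1,0,0],[1,0,0,0]]"

definition Sz :: "nat \<Rightarrow> 'a::field mat set" where
  "Sz n = generate Sp4 ({sz_T n a b | a b. True} \<union> {sz_D n l | l. l \<noteq> 0} \<union> {sz_W})"

end

theory Submission
  imports Defs "Jordan_Normal_Form.VS_Connect" "HOL-Algebra.Multiplicative_Group"
begin

text \<open>Let \<open>P\<close> be the stabilizer in \<open>G = Sp4\<close> of the line through \<open>e\<^sub>4\<close>, and let \<open>\<mu>\<close> be the linear
  character of \<open>P\<close> that applies a character \<open>\<nu>\<close> of the multiplicative group of the field, with
  \<open>\<nu>\<^sup>2\<close> nontrivial, to the eigenvalue on that line. By Mackey's criterion \<open>\<mu>\<close> induces an irreducible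
  character \<open>\<chi>\<close> of \<open>G\<close>. The intersection \<open>B\<close> of \<open>P\<close> with the Suzuki group \<open>H\<close> is the Borel
  subgroup of \<open>H\<close>, and by the Bruhat decomposition of \<open>H\<close> the restriction of \<open>\<mu>\<close> to \<open>B\<close> induces
  an irreducible character \<open>\<psi>\<close> of \<open>H\<close>. The inner product of \<open>\<chi>\<close> with the character of \<open>G\<close> induced
  by \<open>\<psi>\<close> counts the orbits of \<open>B\<close> on the points of projective space on whose stabilizers the two
  linear characters agree. The point \<open>e\<^sub>4\<close> itself is such an orbit, and so is the orbit of
  \<open>e\<^sub>1 + e\<^sub>4\<close>, whose stabilizer in \<open>B\<close> is trivial. So the inner product is at least 2.\<close>

section \<open>Characters of finite fields\<close>

text \<open>Multiplication by a nonzero \<open>x\<close> permutes the nonzero elements. Their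
  product therefore equals itself times \<open>x\<close> to the power q - 1, and it can be
  cancelled.\<close>

lemma finite_field_power_card:
  fixes x :: "'a::{field, finite}"
  shows "x ^ card (UNIV :: 'a set) = x"
proof (cases "x = 0")
  case False
  define P where "P = (\<Prod>y\<in>UNIV - {0::'a}. y)"
  have "P = (\<Prod>y\<in>UNIV - {0}. x * y)"
    unfolding P_def
    by (rule prod.reindex_bij_betw[symmetric], rule bij_betwI[where g = "\<lambda>y. y / x"])
      (use False in auto)
  also have "\<dots> = x ^ (card (UNIV :: 'a set) - 1) * P"
    by (simp add: prod.distrib P_def card_Diff_singleton)
  finally have "x ^ (card (UNIV :: 'a set) - 1) = 1" by (simp add: P_def)
  then have "x ^ Suc (card (UNIV :: 'a set) - 1) = x" by simp
  then show ?thesis by (simp add: card_gt_0_iff)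
qed (simp add: card_gt_0_iff)

lemma finite_field_generator:
  obtains \<gamma> :: "'a::{field, finite}" where "\<gamma> \<noteq> 0" "\<And>x. x \<noteq> 0 \<Longrightarrow> \<exists>i::nat. x = \<gamma> ^ i"
proof -
  let ?R = "class_ring :: 'a ring"
  have pow: "y [^]\<^bsub>?R\<^esub> i = y ^ i" for y :: 'a and i :: nat
    by (induction i) (simp_all add: nat_pow_def)
  have "finite (carrier ?R)" by simp
  from field.finite_field_mult_group_has_gen[OF class_field.field_axioms this]
  obtain \<gamma> where \<gamma>: "\<gamma> \<in> carrier (mult_of ?R)"
    "carrier (mult_of ?R) = {\<gamma> [^]\<^bsub>?R\<^esub> i | i::nat. i \<in> UNIV}" by blast
  have car: "carrier (mult_of ?R) = UNIV - {0}" by simp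
  show thesis
  proof
    show "\<gamma> \<noteq> 0" using \<gamma>(1) car by simp
    fix x :: 'a assume "x \<noteq> 0"
    then have "x \<in> {\<gamma> [^]\<^bsub>?R\<^esub> i | i::nat. i \<in> UNIV}" unfolding \<gamma>(2)[symmetric] car by simp
    then show "\<exists>i::nat. x = \<gamma> ^ i" by (auto simp: pow)
  qed
qed

text \<open>A generator of the multiplicative group is sent to a primitive \<open>m\<close>-th root
  of unity, where \<open>m\<close> is q - 1. Having more than 3 elements gives \<open>m > 2\<close>,
  so the square of this root differs from 1.\<close>

lemma finite_field_character:
  assumes "card (UNIV :: 'a::{field, finite} set) > 3"
  obtains \<nu> :: "'a::{field, finite} \<Rightarrow> complex" and s :: "'a::{field, finite}" where
    "\<And>x y. x \<noteq> 0 \<Longrightarrow> y \<noteq> 0 \<Longrightarrow> \<nu> (x * y) = \<nu> x * \<nu> y"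
    "\<And>x. x \<noteq> 0 \<Longrightarrow> \<nu> x * cnj (\<nu> x) = 1"
    "s \<noteq> 0" "\<nu> s * \<nu> s \<noteq> 1"
proof -
  obtain \<gamma> :: 'a where \<gamma>: "\<gamma> \<noteq> 0" "\<And>x. x \<noteq> 0 \<Longrightarrow> \<exists>i::nat. x = \<gamma> ^ i"
    using finite_field_generator by blast
  define m where "m = card (UNIV :: 'a set) - 1"
  have m: "m > 2" using assms by (simp add: m_def)
  have Suc_m: "Suc m = card (UNIV :: 'a set)" using assms by (simp add: m_def)
  have "\<gamma> ^ Suc m = \<gamma>" unfolding Suc_m by (rule finite_field_power_card)
  with \<gamma>(1) have \<gamma>_m: "\<gamma> ^ m = 1" by simp
  define \<omega> where "\<omega> = cis (2 * pi / m)"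
  have \<omega>_pow: "\<omega> ^ i = cis (2 * pi * i / m)" for i
    by (simp add: \<omega>_def DeMoivre mult.commute)
  have \<omega>_m: "\<omega> ^ m = 1" using m by (simp add: \<omega>_pow)
  have pow_mod: "z ^ i = z ^ (i mod m)" if "z ^ m = 1" for z :: "'b::monoid_mult" and i
  proof -
    have "z ^ i = z ^ (m * (i div m) + i mod m)" by simp
    also have "\<dots> = z ^ (i mod m)" unfolding power_add power_mult that by simp
    finally show ?thesis .
  qed
  have surj: "(\<lambda>i. \<gamma> ^ i) ` {..<m} = UNIV - {0}"
  proof
    show "UNIV - {0} \<subseteq> (\<lambda>i. \<gamma> ^ i) ` {..<m}"
    proof
      fix x :: 'a assume "x \<in> UNIV - {0}"
      then obtain i :: nat where "x = \<gamma> ^ i" using \<gamma>(2) by auto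
      then have "x = \<gamma> ^ (i mod m)" using pow_mod[OF \<gamma>_m] by simp
      then show "x \<in> (\<lambda>i. \<gamma> ^ i) ` {..<m}" using m by auto
    qed
  qed (use \<gamma> in auto)
  have "card (UNIV - {0::'a}) = m" by (simp add: m_def card_Diff_singleton)
  then have inj: "inj_on (\<lambda>i. \<gamma> ^ i) {..<m}"
    using surj by (intro eq_card_imp_inj_on) auto
  \<comment> \<open>The discrete logarithm to base \<open>\<gamma>\<close>, with values below
    \<open>m\<close>. It is additive only modulo \<open>m\<close>, which is harmless because
    \<open>\<omega> ^ m = 1\<close>.\<close>
  define lg where "lg = the_inv_into {..<m} (\<lambda>i. \<gamma> ^ i)"
  have lg: "\<gamma> ^ lg x = x" if "x \<noteq> 0" for x
    unfolding lg_def by (rule f_the_inv_into_f[OF inj]) (use surj that in auto)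
  have lg_pow: "\<omega> ^ lg (\<gamma> ^ i) = \<omega> ^ i" for i
  proof -
    have "lg (\<gamma> ^ i) = i mod m"
      unfolding pow_mod[OF \<gamma>_m, of i] lg_def using m by (intro the_inv_into_f_f[OF inj]) auto
    then show ?thesis using pow_mod[OF \<omega>_m] by metis
  qed
  show thesis
  proof
    fix x y :: 'a assume "x \<noteq> 0" "y \<noteq> 0"
    then have "x * y = \<gamma> ^ (lg x + lg y)" by (simp add: power_add lg)
    then have "\<omega> ^ lg (x * y) = \<omega> ^ (lg x + lg y)" by (simp only: lg_pow)
    then show "\<omega> ^ lg (x * y) = \<omega> ^ lg x * \<omega> ^ lg y" by (simp only: power_add)
  next
    fix x :: 'a
    show "\<omega> ^ lg x * cnj (\<omega> ^ lg x) = 1"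
      by (simp add: \<omega>_pow cis_cnj cis_mult)
  next
    show "\<gamma> \<noteq> 0" by fact
    have "inj_on (\<lambda>k. cis (2 * pi * real k / real m)) {..<m}"
      using bij_betw_roots_unity[of m] m by (auto simp: bij_betw_def)
    then have "cis (2 * pi * real 2 / real m) \<noteq> cis (2 * pi * real 0 / real m)"
      using m by (auto dest!: inj_onD[of _ _ 2 0])
    then have "\<omega> ^ 2 \<noteq> 1" unfolding \<omega>_pow by simp
    moreover have "\<omega> ^ lg \<gamma> = \<omega>" using lg_pow[of 1] by simp
    ultimately show "\<omega> ^ lg \<gamma> * \<omega> ^ lg \<gamma> \<noteq> 1" by (simp add: power2_eq_square)
  qed
qed

text \<open>The element -1 equals its own q-th power, and an even power of -1 is 1.\<close>

lemma char_two_of_even_card: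
  assumes "even (card (UNIV :: 'a::{field, finite} set))"
  shows "(2::'a) = 0"
proof -
  have "(- 1 :: 'a) = (- 1) ^ card (UNIV :: 'a set)" by (rule finite_field_power_card[symmetric])
  also have "\<dots> = 1" using assms by simp
  finally have "(1::'a) + 1 = 0" by (metis add.right_inverse)
  then show ?thesis by simp
qed

section \<open>Monomial characters\<close>

locale monomial = group G for G (structure) +
  fixes K :: "'a set" and \<mu> :: "'a \<Rightarrow> complex"
  assumes finite_carrier: "finite (carrier G)"
    and subgroup_K: "subgroup K G"
    and mu_mult: "\<lbrakk>a \<in> K; b \<in> K\<rbrakk> \<Longrightarrow> \<mu> (a \<otimes> b) = \<mu> a * \<mu> b"
    and mu_unit: "a \<in> K \<Longrightarrow> \<mu> a * cnj (\<mu> a) = 1"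
begin

definition mu0 :: "'a \<Rightarrow> complex" where
  "mu0 g = (if g \<in> K then \<mu> g else 0)"

text \<open>Frobenius's formula for the character induced from \<open>K\<close>. It agrees on the
  group with \<open>induced_char\<close> after replacing \<open>x\<close> by its inverse;
  conjugating this way round fits the left cosets that index the basis of the induced
  representation.\<close>

definition ind :: "'a \<Rightarrow> complex" where
  "ind g = (\<Sum>x\<in>carrier G. mu0 (inv x \<otimes> g \<otimes> x)) / of_nat (card K)"

lemmas K_closed [simp] = subgroup.m_closed[OF subgroup_K] subgroup.m_inv_closed[OF subgroup_K]
  subgroup.one_closed[OF subgroup_K]

lemma K_carrier [simp]: "k \<in> K \<Longrightarrow> k \<in> carrier G"
  using subgroup.mem_carrier[OF subgroup_K] .

lemma finite_K: "finite K"
  using finite_carrier subgroup.subset[OF subgroup_K] finite_subset by blast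

lemma card_K_pos: "card K > 0"
  using finite_K K_closed(3) card_gt_0_iff by blast

lemma mu_nonzero: "a \<in> K \<Longrightarrow> \<mu> a \<noteq> 0"
  using mu_unit by fastforce

lemma mu_one: "\<mu> \<one> = 1"
  using mu_mult[of \<one> \<one>] mu_nonzero[of \<one>] by simp

lemma mu_inv: "a \<in> K \<Longrightarrow> \<mu> (inv a) * \<mu> a = 1"
  using mu_mult[of "inv a" a] mu_one by simp

lemma inv_cancel [simp]:
  assumes "x \<in> carrier G" "y \<in> carrier G"
  shows "inv x \<otimes> (x \<otimes> y) = y" "x \<otimes> (inv x \<otimes> y) = y"
  using assms by (simp_all add: m_assoc[symmetric])

lemma mult_K_iff_left: "\<lbrakk>k \<in> K; g \<in> carrier G\<rbrakk> \<Longrightarrow> k \<otimes> g \<in> K \<longleftrightarrow> g \<in> K"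
proof
  assume *: "k \<in> K" "g \<in> carrier G" "k \<otimes> g \<in> K"
  then have "inv k \<otimes> (k \<otimes> g) \<in> K" using K_closed(1,2) by blast
  with * show "g \<in> K" by simp
qed auto

lemma mult_K_iff_right: "\<lbrakk>k \<in> K; g \<in> carrier G\<rbrakk> \<Longrightarrow> g \<otimes> k \<in> K \<longleftrightarrow> g \<in> K"
proof
  assume *: "k \<in> K" "g \<in> carrier G" "g \<otimes> k \<in> K"
  then have "(g \<otimes> k) \<otimes> inv k \<in> K" using K_closed(1,2) by blast
  with * show "g \<in> K" by (simp add: m_assoc)
qed auto

lemma mu0_left: "\<lbrakk>k \<in> K; g \<in> carrier G\<rbrakk> \<Longrightarrow> mu0 (k \<otimes> g) = \<mu> k * mu0 g"
  by (auto simp: mu0_def mult_K_iff_left mu_mult)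

lemma mu0_right: "\<lbrakk>k \<in> K; g \<in> carrier G\<rbrakk> \<Longrightarrow> mu0 (g \<otimes> k) = mu0 g * \<mu> k"
  by (auto simp: mu0_def mult_K_iff_right mu_mult)

lemma mu0_conj:
  assumes "k \<in> K" "g \<in> carrier G"
  shows "mu0 (inv k \<otimes> g \<otimes> k) = mu0 g"
proof -
  have "mu0 (inv k \<otimes> g \<otimes> k) = (\<mu> (inv k) * \<mu> k) * mu0 g"
    using assms by (simp add: mu0_right mu0_left)
  then show ?thesis using assms mu_inv by simp
qed

lemma transversal:
  obtains d :: nat and x where "\<And>i. i < d \<Longrightarrow> x i \<in> carrier G"
    and "\<And>g. g \<in> carrier G \<Longrightarrow> \<exists>!i. i < d \<and> inv (x i) \<otimes> g \<in> K"
proof -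
  \<comment> \<open>The condition under the choice operator depends only on the left coset of
    \<open>g\<close>, so \<open>r\<close> picks one representative per coset.\<close>
  define r where "r g = (SOME y. y \<in> carrier G \<and> inv y \<otimes> g \<in> K)" for g
  have r: "r g \<in> carrier G" "inv (r g) \<otimes> g \<in> K" if "g \<in> carrier G" for g
  proof -
    have "\<exists>y. y \<in> carrier G \<and> inv y \<otimes> g \<in> K" using that by (intro exI[of _ g]) auto
    from someI_ex[OF this] show "r g \<in> carrier G" "inv (r g) \<otimes> g \<in> K" unfolding r_def by auto
  qed
  have r_eq: "r y = r g" if "g \<in> carrier G" "y \<in> carrier G" "inv y \<otimes> g \<in> K" for y g
  proof -
    have "(inv z \<otimes> y \<in> K) = (inv z \<otimes> g \<in> K)" if z: "z \<in> carrier G" for z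
    proof -
      have "(inv z \<otimes> y) \<otimes> (inv y \<otimes> g) = inv z \<otimes> g"
        using that \<open>g \<in> carrier G\<close> \<open>y \<in> carrier G\<close> by (simp add: m_assoc)
      then show ?thesis
        using mult_K_iff_right[OF \<open>inv y \<otimes> g \<in> K\<close>, of "inv z \<otimes> y"] z \<open>y \<in> carrier G\<close> by simp
    qed
    then show ?thesis unfolding r_def by (intro arg_cong[where f = Eps] ext) auto
  qed
  define R where "R = r ` carrier G"
  have "finite R" using finite_carrier by (simp add: R_def)
  then obtain x where x: "bij_betw x {..<card R} R"
    using ex_bij_betw_nat_finite[of R] by (auto simp: atLeast0LessThan)
  have R: "R \<subseteq> carrier G" using r by (auto simp: R_def)
  have rr: "r y = y" if "y \<in> R" for y
  proof -
    from that obtain g where g: "g \<in> carrier G" "y = r g" by (auto simp: R_def)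
    then show ?thesis using r[OF g(1)] r_eq[of g y] by simp
  qed
  show thesis
  proof
    show "x i \<in> carrier G" if "i < card R" for i
      using x R that by (auto simp: bij_betw_def)
    fix g assume g: "g \<in> carrier G"
    then have "r g \<in> R" by (simp add: R_def)
    then have "r g \<in> x ` {..<card R}" using x by (simp add: bij_betw_def)
    then obtain i where i: "i < card R" "x i = r g" by auto
    show "\<exists>!i. i < card R \<and> inv (x i) \<otimes> g \<in> K"
    proof (rule ex1I)
      show "i < card R \<and> inv (x i) \<otimes> g \<in> K" using i r g by simp
      fix j assume j: "j < card R \<and> inv (x j) \<otimes> g \<in> K"
      then have "x j \<in> R" using x by (auto simp: bij_betw_def)
      then have "x j = r g" using r_eq[of g "x j"] g j rr R by auto
      then show "j = i" using i j x by (auto simp: bij_betw_def inj_on_def)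
    qed
  qed
qed

text \<open>Mackey's criterion. The stabilizer of the coset \<open>x j K\<close> projects every vector \<open>w\<close> to
  its \<open>j\<close>-th coordinate: averaging \<open>w\<close> over it against \<open>\<mu>\<close> annihilates all other coordinates.\<close>

lemma irr_char_ind:
  assumes mackey: "\<And>g. \<lbrakk>g \<in> carrier G; g \<notin> K\<rbrakk> \<Longrightarrow>
    \<exists>k\<in>K. \<exists>k'\<in>K. k \<otimes> g = g \<otimes> k' \<and> \<mu> k \<noteq> \<mu> k'"
  shows "irr_char G ind"
proof -
  obtain d :: nat and x where x: "\<And>i. i < d \<Longrightarrow> x i \<in> carrier G"
    and ex1: "\<And>g. g \<in> carrier G \<Longrightarrow> \<exists>!i. i < d \<and> inv (x i) \<otimes> g \<in> K"
    using transversal by blast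
  note [simp] = x
  have delta: "inv (x i) \<otimes> x j \<in> K \<longleftrightarrow> i = j" if "i < d" "j < d" for i j
  proof -
    have "inv (x j) \<otimes> x j \<in> K" using that by simp
    then show ?thesis using ex1[OF x[OF that(2)]] that by blast
  qed
  \<comment> \<open>For \<open>g\<close> in the group this is the monomial matrix of
    \<open>g\<close> in the representation induced by \<open>\<mu>\<close>, with the cosets
    \<open>x i K\<close> as basis.\<close>
  define \<rho> where "\<rho> g = mat d d (\<lambda>(i,j). mu0 (inv (x i) \<otimes> g \<otimes> x j))" for g
  have \<rho>_carrier: "\<rho> g \<in> carrier_mat d d" for g by (simp add: \<rho>_def)
  \<comment> \<open>Only the coset that contains \<open>b\<close> contributes, since
    \<open>mu0\<close> vanishes outside \<open>K\<close>. Multiplicativity of \<open>\<rho>\<close>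
    is an instance of this.\<close>
  have contract: "(\<Sum>j<d. mu0 (a \<otimes> x j) * mu0 (inv (x j) \<otimes> b)) = mu0 (a \<otimes> b)"
    if ab: "a \<in> carrier G" "b \<in> carrier G" for a b
  proof -
    obtain j where j: "j < d" "inv (x j) \<otimes> b \<in> K"
      and ju: "\<And>i. i < d \<Longrightarrow> inv (x i) \<otimes> b \<in> K \<Longrightarrow> i = j"
      using ex1[OF ab(2)] by blast
    have "(\<Sum>i<d. mu0 (a \<otimes> x i) * mu0 (inv (x i) \<otimes> b))
        = (\<Sum>i<d. if i = j then mu0 (a \<otimes> x j) * mu0 (inv (x j) \<otimes> b) else 0)"
    proof (rule sum.cong[OF refl])
      fix i assume i: "i \<in> {..<d}"
      show "mu0 (a \<otimes> x i) * mu0 (inv (x i) \<otimes> b)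
        = (if i = j then mu0 (a \<otimes> x j) * mu0 (inv (x j) \<otimes> b) else 0)"
      proof (cases "i = j")
        case False
        then have "inv (x i) \<otimes> b \<notin> K" using ju i by blast
        with False show ?thesis by (simp add: mu0_def)
      qed simp
    qed
    also have "\<dots> = mu0 (a \<otimes> x j) * \<mu> (inv (x j) \<otimes> b)"
      using j by (simp add: mu0_def)
    also have "\<dots> = mu0 ((a \<otimes> x j) \<otimes> (inv (x j) \<otimes> b))"
      using j ab by (subst mu0_right) auto
    also have "(a \<otimes> x j) \<otimes> (inv (x j) \<otimes> b) = a \<otimes> b"
      using j ab by (simp add: m_assoc)
    finally show ?thesis .
  qed
  have one: "\<rho> \<one> = 1\<^sub>m d"
    by (rule eq_matI) (auto simp: \<rho>_def mu0_def delta mu_one)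
  have mult: "\<rho> (g \<otimes> h) = \<rho> g * \<rho> h" if gh: "g \<in> carrier G" "h \<in> carrier G" for g h
  proof (rule eq_matI)
    fix i k assume "i < dim_row (\<rho> g * \<rho> h)" "k < dim_col (\<rho> g * \<rho> h)"
    then have ik: "i < d" "k < d" by (auto simp: \<rho>_def)
    have "(\<rho> g * \<rho> h) $$ (i,k)
        = (\<Sum>j<d. mu0 ((inv (x i) \<otimes> g) \<otimes> x j) * mu0 (inv (x j) \<otimes> (h \<otimes> x k)))"
      using ik gh by (auto simp: \<rho>_def scalar_prod_def atLeast0LessThan m_assoc intro!: sum.cong)
    also have "\<dots> = mu0 ((inv (x i) \<otimes> g) \<otimes> (h \<otimes> x k))"
      using ik gh by (intro contract) auto
    finally show "\<rho> (g \<otimes> h) $$ (i,k) = (\<rho> g * \<rho> h) $$ (i,k)"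
      using ik gh by (simp add: \<rho>_def m_assoc)
  qed (auto simp: \<rho>_def)
  have rep: "is_rep G d \<rho>"
    using \<rho>_carrier one mult by (auto simp: is_rep_def)
  have "d > 0" using ex1[of \<one>] by auto
  have app: "(\<rho> g *\<^sub>v w) $ i = (\<Sum>m<d. mu0 (inv (x i) \<otimes> g \<otimes> x m) * w $ m)"
    if "i < d" "w \<in> carrier_vec d" for g w i
    using that by (simp add: \<rho>_def scalar_prod_def atLeast0LessThan)
  have irr: "W = {0\<^sub>v d} \<or> W = carrier_vec d"
    if W: "is_subspace_vec d W" and inv_W: "\<forall>g\<in>carrier G. \<forall>w\<in>W. \<rho> g *\<^sub>v w \<in> W" for W
  proof (cases "W = {0\<^sub>v d}")
    case False
    have W_sub: "W \<subseteq> carrier_vec d" and W_0: "0\<^sub>v d \<in> W"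
      and W_add: "\<And>v w. v \<in> W \<Longrightarrow> w \<in> W \<Longrightarrow> v + w \<in> W"
      and W_smult: "\<And>c v. v \<in> W \<Longrightarrow> c \<cdot>\<^sub>v v \<in> W"
      using W by (auto simp: is_subspace_vec_def)
    have W_sum: "vec d (\<lambda>i. \<Sum>s\<in>S. f s $ i) \<in> W" if "finite S" "\<And>s. s \<in> S \<Longrightarrow> f s \<in> W"
      for S :: "'z set" and f
      using that
    proof (induction S)
      case empty
      have "vec d (\<lambda>i. \<Sum>s\<in>{}. f s $ i) = 0\<^sub>v d" by (intro eq_vecI) auto
      then show ?case using W_0 by simp
    next
      case (insert s S)
      have "f s \<in> carrier_vec d" using insert W_sub by auto
      then have "vec d (\<lambda>i. \<Sum>s\<in>insert s S. f s $ i) = f s + vec d (\<lambda>i. \<Sum>s\<in>S. f s $ i)"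
        using insert by (intro eq_vecI) auto
      then show ?case using insert W_add by simp
    qed
    from False W_0 obtain w where w: "w \<in> W" "w \<noteq> 0\<^sub>v d" by blast
    then have w_carrier [simp]: "w \<in> carrier_vec d" using W_sub by auto
    have "\<exists>j<d. w $ j \<noteq> 0"
    proof (rule ccontr)
      assume "\<not> ?thesis"
      then have "w = 0\<^sub>v d" using w_carrier by (intro eq_vecI) auto
      with w show False by simp
    qed
    then obtain j where j: "j < d" "w $ j \<noteq> 0" by blast
    \<comment> \<open>For \<open>k\<close> in \<open>K\<close>, the value of \<open>S\<close> at
      \<open>inv (x i) \<otimes> x j \<otimes> k\<close> is the \<open>i\<close>-th coordinate of
      the image of \<open>w\<close> under \<open>x j \<otimes> k \<otimes> inv (x j)\<close>, an
      element of the stabilizer of the coset \<open>x j K\<close>.\<close>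
    define S where "S y = (\<Sum>m<d. mu0 (y \<otimes> inv (x j) \<otimes> x m) * w $ m)" for y
    have S_left: "S (k \<otimes> y) = \<mu> k * S y" if "k \<in> K" "y \<in> carrier G" for k y
      using that j by (auto simp: S_def sum_distrib_left m_assoc mu0_left intro!: sum.cong)
    have S_one: "S \<one> = w $ j"
    proof -
      have "S \<one> = (\<Sum>m<d. if m = j then w $ m else 0)"
        unfolding S_def using j delta[OF j(1)]
        by (intro sum.cong refl) (auto simp: mu0_def mu_one)
      then show ?thesis using j by simp
    qed
    define u where "u = vec d (\<lambda>i. \<Sum>k\<in>K. (cnj (\<mu> k) \<cdot>\<^sub>v (\<rho> (x j \<otimes> k \<otimes> inv (x j)) *\<^sub>v w)) $ i)"
    have "u \<in> W" unfolding u_def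
      using inv_W w(1) j by (intro W_sum finite_K W_smult) auto
    have u_nth: "u $ i = (\<Sum>k\<in>K. cnj (\<mu> k) * S (inv (x i) \<otimes> x j \<otimes> k))" if i: "i < d" for i
    proof -
      have "(\<rho> (x j \<otimes> k \<otimes> inv (x j)) *\<^sub>v w) $ i = S (inv (x i) \<otimes> x j \<otimes> k)" if "k \<in> K" for k
        using i j that by (subst app) (auto simp: S_def m_assoc intro!: sum.cong)
      moreover have "dim_vec (\<rho> (x j \<otimes> k \<otimes> inv (x j)) *\<^sub>v w) = d" for k
        by (simp add: \<rho>_def)
      ultimately show ?thesis using i by (simp add: u_def)
    qed
    have u_j: "u $ j = of_nat (card K) * w $ j"
    proof -
      have "u $ j = (\<Sum>k\<in>K. (\<mu> k * cnj (\<mu> k)) * S \<one>)"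
        unfolding u_nth[OF j(1)]
      proof (rule sum.cong[OF refl])
        fix k assume k: "k \<in> K"
        have "S (inv (x j) \<otimes> x j \<otimes> k) = S (k \<otimes> \<one>)" using j k by simp
        also have "\<dots> = \<mu> k * S \<one>" using k by (intro S_left) auto
        finally show "cnj (\<mu> k) * S (inv (x j) \<otimes> x j \<otimes> k) = (\<mu> k * cnj (\<mu> k)) * S \<one>" by simp
      qed
      then show ?thesis by (simp add: mu_unit S_one)
    qed
    have u_i: "u $ i = 0" if i: "i < d" "i \<noteq> j" for i
    proof -
      \<comment> \<open>Substituting \<open>k' \<otimes> h\<close> for \<open>h\<close> in the
        average multiplies it by \<open>cnj (\<mu> k') * \<mu> k\<close>. This factor is not 1, so
        the coordinate vanishes.\<close>
      define g where "g = inv (x i) \<otimes> x j"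
      have g: "g \<in> carrier G" "g \<notin> K" using i j delta by (auto simp: g_def)
      obtain k k' where k: "k \<in> K" "k' \<in> K" "k \<otimes> g = g \<otimes> k'" "\<mu> k \<noteq> \<mu> k'"
        using mackey[OF g] by blast
      have "u $ i = (\<Sum>h\<in>K. cnj (\<mu> h) * S (g \<otimes> h))"
        using u_nth[OF i(1)] by (simp add: g_def)
      also have "\<dots> = (\<Sum>h\<in>K. cnj (\<mu> (k' \<otimes> h)) * S (g \<otimes> (k' \<otimes> h)))"
      proof (rule sum.reindex_bij_betw[symmetric])
        show "bij_betw (\<lambda>h. k' \<otimes> h) K K"
          by (rule bij_betwI[where g = "\<lambda>h. inv k' \<otimes> h"])
            (use k in \<open>auto simp: m_assoc[symmetric]\<close>)
      qed
      also have "\<dots> = (\<Sum>h\<in>K. (cnj (\<mu> k') * \<mu> k) * (cnj (\<mu> h) * S (g \<otimes> h)))"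
      proof (rule sum.cong[OF refl])
        fix h assume h: "h \<in> K"
        have "g \<otimes> (k' \<otimes> h) = k \<otimes> (g \<otimes> h)"
          using k g h by (simp add: m_assoc[symmetric])
        then show "cnj (\<mu> (k' \<otimes> h)) * S (g \<otimes> (k' \<otimes> h))
            = (cnj (\<mu> k') * \<mu> k) * (cnj (\<mu> h) * S (g \<otimes> h))"
          using k g h by (simp add: S_left mu_mult)
      qed
      also have "\<dots> = (cnj (\<mu> k') * \<mu> k) * u $ i"
        using u_nth[OF i(1)] by (simp add: g_def sum_distrib_left)
      finally have "u $ i = 0 \<or> cnj (\<mu> k') * \<mu> k = 1" by simp
      moreover have "cnj (\<mu> k') * \<mu> k \<noteq> 1"
      proof
        assume "cnj (\<mu> k') * \<mu> k = 1"
        then have "\<mu> k' * cnj (\<mu> k') * \<mu> k = \<mu> k'" by (simp add: mult.assoc)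
        with k mu_unit show False by simp
      qed
      ultimately show ?thesis by blast
    qed
    \<comment> \<open>Now \<open>u\<close> is a nonzero multiple of the \<open>j\<close>-th unit
      vector, and \<open>x i \<otimes> inv (x j)\<close> carries that vector to the
      \<open>i\<close>-th one.\<close>
    have unit_W: "unit_vec d i \<in> W" if i: "i < d" for i
    proof -
      define c where "c = of_nat (card K) * w $ j"
      have "u = c \<cdot>\<^sub>v unit_vec d j"
        using u_j u_i j by (intro eq_vecI) (auto simp: u_def c_def)
      moreover have "c \<noteq> 0" using j card_K_pos by (simp add: c_def)
      ultimately have "unit_vec d j = inverse c \<cdot>\<^sub>v u"
        by (simp add: smult_smult_assoc)
      then have uj: "unit_vec d j \<in> W" using W_smult[OF \<open>u \<in> W\<close>] by simp
      have "unit_vec d i = \<rho> (x i \<otimes> inv (x j)) *\<^sub>v unit_vec d j"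
      proof (rule eq_vecI)
        fix m assume "m < dim_vec (\<rho> (x i \<otimes> inv (x j)) *\<^sub>v unit_vec d j)"
        then have m: "m < d" by (simp add: \<rho>_def)
        have "(\<rho> (x i \<otimes> inv (x j)) *\<^sub>v unit_vec d j) $ m
            = (\<Sum>l<d. mu0 (inv (x m) \<otimes> (x i \<otimes> inv (x j)) \<otimes> x l) * unit_vec d j $ l)"
          using m by (intro app) auto
        also have "\<dots> = (\<Sum>l<d. if l = j then mu0 (inv (x m) \<otimes> (x i \<otimes> inv (x j)) \<otimes> x l) else 0)"
          using j by (intro sum.cong refl) simp
        also have "\<dots> = mu0 (inv (x m) \<otimes> x i)" using j i m by (simp add: m_assoc)
        also have "\<dots> = (if m = i then 1 else 0)" using i m delta by (auto simp: mu0_def mu_one)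
        finally show "unit_vec d i $ m = (\<rho> (x i \<otimes> inv (x j)) *\<^sub>v unit_vec d j) $ m"
          using m i by simp
      qed (simp add: \<rho>_def)
      then show ?thesis using inv_W uj i j by auto
    qed
    have "v \<in> W" if v: "v \<in> carrier_vec d" for v
    proof -
      have "v = vec d (\<lambda>i. \<Sum>s<d. (v $ s \<cdot>\<^sub>v unit_vec d s) $ i)"
        using v by (intro eq_vecI) (auto simp: if_distrib sum.delta cong: if_cong)
      moreover have "\<dots> \<in> W" using unit_W by (intro W_sum W_smult) auto
      ultimately show ?thesis by simp
    qed
    then show ?thesis using W_sub by auto
  qed auto
  \<comment> \<open>Every group element is uniquely \<open>x i \<otimes> k\<close> with
    \<open>k\<close> in \<open>K\<close>. Conjugation by \<open>k\<close> does not change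
    \<open>mu0\<close>, so each diagonal entry occurs \<open>card K\<close> times in the sum over
    the group.\<close>
  have trace: "ind g = mat_trace (\<rho> g)" if g: "g \<in> carrier G" for g
  proof -
    have "bij_betw (\<lambda>(i,k). x i \<otimes> k) ({..<d} \<times> K) (carrier G)"
    proof (rule bij_betw_imageI)
      show "inj_on (\<lambda>(i,k). x i \<otimes> k) ({..<d} \<times> K)"
      proof (rule inj_onI, clarsimp)
        fix i k j k' assume *: "i < d" "k \<in> K" "j < d" "k' \<in> K" "x i \<otimes> k = x j \<otimes> k'"
        have "inv (x i) \<otimes> (x i \<otimes> k) = k" "inv (x j) \<otimes> (x j \<otimes> k') = k'"
          using *(1-4) by simp_all
        then have "inv (x i) \<otimes> (x i \<otimes> k) \<in> K" "inv (x j) \<otimes> (x i \<otimes> k) \<in> K"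
          using * by simp_all
        moreover have "x i \<otimes> k \<in> carrier G" using * by simp
        ultimately have "i = j" using ex1 *(1,3) by blast
        then show "i = j \<and> k = k'" using * by simp
      qed
      have "h \<in> (\<lambda>(i,k). x i \<otimes> k) ` ({..<d} \<times> K)" if h: "h \<in> carrier G" for h
      proof -
        obtain i where i: "i < d" "inv (x i) \<otimes> h \<in> K" using ex1[OF h] by blast
        then have "h = x i \<otimes> (inv (x i) \<otimes> h)" using h by simp
        with i show ?thesis by (intro image_eqI[of _ _ "(i, inv (x i) \<otimes> h)"]) auto
      qed
      then show "(\<lambda>(i,k). x i \<otimes> k) ` ({..<d} \<times> K) = carrier G" by auto
    qed
    then have "(\<Sum>y\<in>carrier G. mu0 (inv y \<otimes> g \<otimes> y))
        = (\<Sum>(i,k)\<in>{..<d} \<times> K. mu0 (inv (x i \<otimes> k) \<otimes> g \<otimes> (x i \<otimes> k)))"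
      by (subst sum.reindex_bij_betw[symmetric]) (auto simp: case_prod_unfold)
    also have "\<dots> = (\<Sum>(i,k)\<in>{..<d} \<times> K. mu0 (inv (x i) \<otimes> g \<otimes> x i))"
    proof (rule sum.cong[OF refl], clarsimp)
      fix i k assume *: "i < d" "k \<in> K"
      have "inv (x i \<otimes> k) \<otimes> g \<otimes> (x i \<otimes> k) = inv k \<otimes> (inv (x i) \<otimes> g \<otimes> x i) \<otimes> k"
        using * g by (simp add: inv_mult_group m_assoc)
      then show "mu0 (inv (x i \<otimes> k) \<otimes> g \<otimes> (x i \<otimes> k)) = mu0 (inv (x i) \<otimes> g \<otimes> x i)"
        using mu0_conj[OF *(2)] * g by simp
    qed
    also have "\<dots> = of_nat (card K) * (\<Sum>i<d. mu0 (inv (x i) \<otimes> g \<otimes> x i))"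
      by (simp add: sum.cartesian_product[symmetric] sum_distrib_left)
    finally show ?thesis using card_K_pos by (simp add: ind_def mat_trace_def \<rho>_def)
  qed
  show ?thesis
    unfolding irr_char_def is_irr_rep_def using rep \<open>d > 0\<close> irr trace by blast
qed

section \<open>Mackey's formula for the inner product of induced characters\<close>

lemma ind_conj:
  assumes "x \<in> carrier G" "g \<in> carrier G"
  shows "ind (inv x \<otimes> g \<otimes> x) = ind g"
proof -
  have "(\<Sum>y\<in>carrier G. mu0 (inv y \<otimes> (inv x \<otimes> g \<otimes> x) \<otimes> y))
      = (\<Sum>y\<in>carrier G. mu0 (inv (x \<otimes> y) \<otimes> g \<otimes> (x \<otimes> y)))"
    using assms by (intro sum.cong refl) (simp add: inv_mult_group m_assoc)
  also have "\<dots> = (\<Sum>y\<in>carrier G. mu0 (inv y \<otimes> g \<otimes> y))"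
    by (rule sum.reindex_bij_betw, rule bij_betwI[where g = "\<lambda>y. inv x \<otimes> y"])
      (use assms in auto)
  finally show ?thesis by (simp add: ind_def)
qed

lemma bij_betw_conj:
  assumes "subgroup H G" "x \<in> H"
  shows "bij_betw (\<lambda>g. inv x \<otimes> g \<otimes> x) H H"
proof -
  interpret H: subgroup H G by fact
  show ?thesis
    by (rule bij_betwI[where g = "\<lambda>g. x \<otimes> g \<otimes> inv x"]) (use assms in \<open>auto simp: m_assoc\<close>)
qed

text \<open>This makes the whole locale available inside \<open>H\<close>: it supplies the character
  of the subgroup and, through \<open>irr_char_ind\<close>, its irreducibility.\<close>

lemma monomial_Int:
  assumes "subgroup H G"
  shows "monomial (G\<lparr>carrier := H\<rparr>) (K \<inter> H) \<mu>"
proof -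
  interpret H: subgroup H G by fact
  interpret GH: group "G\<lparr>carrier := H\<rparr>" using H.subgroup_is_group[OF is_group] .
  have "subgroup (K \<inter> H) G" by (rule subgroups_Inter_pair[OF subgroup_K assms])
  then have "subgroup (K \<inter> H) (G\<lparr>carrier := H\<rparr>)"
    by (rule subgroup_incl) (use assms in auto)
  moreover have "finite H" using H.subset finite_carrier finite_subset by blast
  ultimately show ?thesis
    by (intro monomial.intro GH.is_group monomial_axioms.intro) (auto simp: mu_mult mu_unit)
qed

text \<open>Frobenius reciprocity, used twice. As \<open>ind\<close> is a class function, pairing it
  with a character induced from \<open>H\<close> reduces to a sum over \<open>H\<close>, then to one
  over \<open>K \<inter> H\<close>; there \<open>ind\<close> is expanded by its definition.\<close>

lemma char_inner_induced:
  assumes H: "subgroup H G"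
  shows "char_inner G (induced_char G H (monomial.ind (G\<lparr>carrier := H\<rparr>) (K \<inter> H) \<mu>)) ind
    = (\<Sum>x\<in>carrier G. \<Sum>b\<in>K \<inter> H. \<mu> b * cnj (mu0 (inv x \<otimes> b \<otimes> x)))
      / (of_nat (card (K \<inter> H)) * of_nat (card K))"
proof -
  interpret H: subgroup H G by fact
  interpret M: monomial "G\<lparr>carrier := H\<rparr>" "K \<inter> H" \<mu> by (rule monomial_Int[OF H])
  have finH: "finite H" using H.subset finite_carrier finite_subset by blast
  have cardH: "card H > 0" using finH H.one_closed card_gt_0_iff by blast
  have cardG: "card (carrier G) > 0" using finite_carrier one_closed card_gt_0_iff by blast
  have Hc [simp]: "h \<in> carrier G" if "h \<in> H" for h using that by (rule H.mem_carrier)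
  have psi: "M.ind h = (\<Sum>y\<in>H. mu0 (inv y \<otimes> h \<otimes> y)) / of_nat (card (K \<inter> H))" if "h \<in> H" for h
  proof -
    have "M.mu0 (inv\<^bsub>G\<lparr>carrier := H\<rparr>\<^esub> y \<otimes> h \<otimes> y) = mu0 (inv y \<otimes> h \<otimes> y)" if "y \<in> H" for y
      using that \<open>h \<in> H\<close> m_inv_consistent[OF H] by (simp add: M.mu0_def mu0_def)
    then show ?thesis by (simp add: M.ind_def)
  qed
  have ind_conj': "ind g = ind (x \<otimes> g \<otimes> inv x)" if "x \<in> carrier G" "g \<in> carrier G" for x g
    using ind_conj[of "inv x" g] that by simp
  have "(\<Sum>g\<in>carrier G. induced_char G H M.ind g * cnj (ind g))
     = (\<Sum>g\<in>carrier G. \<Sum>x\<in>carrier G.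
          (if x \<otimes> g \<otimes> inv x \<in> H then M.ind (x \<otimes> g \<otimes> inv x) else 0)
          * cnj (ind (x \<otimes> g \<otimes> inv x))) / of_nat (card H)"
    unfolding induced_char_def Let_def
    by (simp add: sum_distrib_right sum_divide_distrib ind_conj'[symmetric])
  also have "(\<Sum>g\<in>carrier G. \<Sum>x\<in>carrier G.
          (if x \<otimes> g \<otimes> inv x \<in> H then M.ind (x \<otimes> g \<otimes> inv x) else 0)
          * cnj (ind (x \<otimes> g \<otimes> inv x)))
      = (\<Sum>x\<in>carrier G. \<Sum>g\<in>carrier G. (if g \<in> H then M.ind g else 0) * cnj (ind g))"
  proof (subst sum.swap, rule sum.cong[OF refl])
    fix x assume x: "x \<in> carrier G"
    have "bij_betw (\<lambda>g. x \<otimes> g \<otimes> inv x) (carrier G) (carrier G)"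
      using bij_betw_conj[OF subgroup_self, of "inv x"] x by simp
    then show "(\<Sum>g\<in>carrier G. (if x \<otimes> g \<otimes> inv x \<in> H then M.ind (x \<otimes> g \<otimes> inv x) else 0)
          * cnj (ind (x \<otimes> g \<otimes> inv x)))
        = (\<Sum>g\<in>carrier G. (if g \<in> H then M.ind g else 0) * cnj (ind g))"
      by (rule sum.reindex_bij_betw)
  qed
  also have "\<dots> = of_nat (card (carrier G)) * (\<Sum>h\<in>H. M.ind h * cnj (ind h))"
  proof -
    have "(\<Sum>g\<in>carrier G. (if g \<in> H then M.ind g else 0) * cnj (ind g))
        = (\<Sum>g\<in>carrier G \<inter> H. M.ind g * cnj (ind g))"
      using finite_carrier by (subst sum.inter_restrict) (auto intro!: sum.cong)
    moreover have "carrier G \<inter> H = H" using H.subset by auto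
    ultimately show ?thesis by simp
  qed
  also have "(\<Sum>h\<in>H. M.ind h * cnj (ind h))
      = (\<Sum>h\<in>H. \<Sum>y\<in>H. mu0 (inv y \<otimes> h \<otimes> y) * cnj (ind (inv y \<otimes> h \<otimes> y))) / of_nat (card (K \<inter> H))"
    by (simp add: psi sum_distrib_right sum_divide_distrib ind_conj)
  also have "(\<Sum>h\<in>H. \<Sum>y\<in>H. mu0 (inv y \<otimes> h \<otimes> y) * cnj (ind (inv y \<otimes> h \<otimes> y)))
      = (\<Sum>y\<in>H. \<Sum>h\<in>H. mu0 h * cnj (ind h))"
    by (subst sum.swap, rule sum.cong[OF refl])
      (rule sum.reindex_bij_betw[OF bij_betw_conj[OF H]])
  also have "\<dots> = of_nat (card H) * (\<Sum>b\<in>K \<inter> H. \<mu> b * cnj (ind b))"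
  proof -
    have "(\<Sum>h\<in>H. mu0 h * cnj (ind h)) = (\<Sum>h\<in>H. if h \<in> K then \<mu> h * cnj (ind h) else 0)"
      by (rule sum.cong) (auto simp: mu0_def)
    also have "\<dots> = (\<Sum>b\<in>H \<inter> K. \<mu> b * cnj (ind b))"
      using finH by (rule sum.inter_restrict[symmetric])
    finally show ?thesis by (simp add: Int_commute)
  qed
  also have "(\<Sum>b\<in>K \<inter> H. \<mu> b * cnj (ind b))
      = (\<Sum>x\<in>carrier G. \<Sum>b\<in>K \<inter> H. \<mu> b * cnj (mu0 (inv x \<otimes> b \<otimes> x))) / of_nat (card K)"
    by (subst sum.swap) (simp add: ind_def sum_distrib_left sum_divide_distrib)
  finally show ?thesis
    using cardH cardG by (simp add: char_inner_def field_simps)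
qed

text \<open>The nonzero terms run over the subgroup \<open>S\<close>, on which they form a linear
  character \<open>\<theta>\<close>. The sum of a linear character is 0 or the order of the
  group.\<close>

lemma inner_term_nonneg:
  assumes H: "subgroup H G" and x: "x \<in> carrier G"
  shows "0 \<le> Re (\<Sum>b\<in>K \<inter> H. \<mu> b * cnj (mu0 (inv x \<otimes> b \<otimes> x)))"
proof -
  interpret H: subgroup H G by fact
  have Hc [simp]: "h \<in> carrier G" if "h \<in> H" for h using that by (rule H.mem_carrier)
  define \<theta> where "\<theta> b = \<mu> b * cnj (\<mu> (inv x \<otimes> b \<otimes> x))" for b
  define S where "S = {b \<in> K \<inter> H. inv x \<otimes> b \<otimes> x \<in> K}"
  have conj_mult: "inv x \<otimes> (a \<otimes> b) \<otimes> x = (inv x \<otimes> a \<otimes> x) \<otimes> (inv x \<otimes> b \<otimes> x)"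
    if "a \<in> K" "b \<in> K" for a b using that x by (simp add: m_assoc)
  have conj_inv: "inv x \<otimes> inv a \<otimes> x = inv (inv x \<otimes> a \<otimes> x)" if "a \<in> K" for a
    using that x by (simp add: m_assoc inv_mult_group)
  have S_mult: "a \<otimes> b \<in> S" if "a \<in> S" "b \<in> S" for a b
    using that by (auto simp: S_def conj_mult)
  have S_inv: "inv a \<in> S" if "a \<in> S" for a
    using that by (auto simp: S_def conj_inv)
  have "(\<Sum>b\<in>K \<inter> H. \<mu> b * cnj (mu0 (inv x \<otimes> b \<otimes> x)))
      = (\<Sum>b\<in>K \<inter> H. if inv x \<otimes> b \<otimes> x \<in> K then \<theta> b else 0)"
    by (rule sum.cong) (auto simp: mu0_def \<theta>_def)
  also have "\<dots> = (\<Sum>b\<in>S. \<theta> b)"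
    unfolding S_def using finite_K by (intro sum.inter_filter[symmetric]) simp
  also have "0 \<le> Re \<dots>"
  proof (cases "\<exists>a\<in>S. \<theta> a \<noteq> 1")
    case True
    then obtain a where a: "a \<in> S" "\<theta> a \<noteq> 1" by blast
    have "(\<Sum>b\<in>S. \<theta> b) = (\<Sum>b\<in>S. \<theta> (a \<otimes> b))"
    proof (rule sum.reindex_bij_betw[symmetric])
      show "bij_betw (\<lambda>b. a \<otimes> b) S S"
        using a S_mult S_inv by (intro bij_betwI[where g = "\<lambda>b. inv a \<otimes> b"]) (auto simp: S_def)
    qed
    also have "\<dots> = (\<Sum>b\<in>S. \<theta> a * \<theta> b)"
      using a by (intro sum.cong) (auto simp: S_def \<theta>_def mu_mult conj_mult)
    also have "\<dots> = \<theta> a * (\<Sum>b\<in>S. \<theta> b)" by (rule sum_distrib_left[symmetric])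
    finally have "(1 - \<theta> a) * (\<Sum>b\<in>S. \<theta> b) = 0" by (simp add: left_diff_distrib)
    with a show ?thesis by simp
  qed simp
  finally show ?thesis .
qed

text \<open>By Mackey's formula each double coset of \<open>K \<inter> H\<close> and \<open>K\<close> contributes 0 or 1 to the inner
  product; those represented by \<open>\<one>\<close> and \<open>x0\<close> contribute 1.\<close>

lemma not_strong_gelfand_pair:
  assumes H: "subgroup H G"
    and mackey: "\<And>g. \<lbrakk>g \<in> carrier G; g \<notin> K\<rbrakk> \<Longrightarrow>
      \<exists>k\<in>K. \<exists>k'\<in>K. k \<otimes> g = g \<otimes> k' \<and> \<mu> k \<noteq> \<mu> k'"
    and mackey_H: "\<And>g. \<lbrakk>g \<in> H; g \<notin> K\<rbrakk> \<Longrightarrow>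
      \<exists>k\<in>K \<inter> H. \<exists>k'\<in>K \<inter> H. k \<otimes> g = g \<otimes> k' \<and> \<mu> k \<noteq> \<mu> k'"
    and x0: "x0 \<in> carrier G" "x0 \<notin> K"
    and triv: "\<And>b. \<lbrakk>b \<in> K \<inter> H; inv x0 \<otimes> b \<otimes> x0 \<in> K\<rbrakk> \<Longrightarrow> b = \<one>"
  shows "\<not> strong_gelfand_pair G H"
proof -
  interpret H: subgroup H G by fact
  interpret M: monomial "G\<lparr>carrier := H\<rparr>" "K \<inter> H" \<mu> by (rule monomial_Int[OF H])
  have Hc [simp]: "h \<in> carrier G" if "h \<in> H" for h using that by (rule H.mem_carrier)
  note [simp] = x0(1)
  define B where "B = K \<inter> H"
  have subB: "subgroup B G" unfolding B_def by (rule subgroups_Inter_pair[OF subgroup_K H])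
  interpret B: subgroup B G by fact
  have finB: "finite B" and cardB: "card B > 0"
    using M.finite_K M.card_K_pos by (simp_all add: B_def)
  define c where "c x = Re (\<Sum>b\<in>B. \<mu> b * cnj (mu0 (inv x \<otimes> b \<otimes> x)))" for x
  have c_nonneg: "0 \<le> c x" if "x \<in> carrier G" for x
    using inner_term_nonneg[OF H that] by (simp add: c_def B_def)
  have c_K: "c x = card B" if x: "x \<in> K" for x
  proof -
    have "mu0 (inv x \<otimes> b \<otimes> x) = \<mu> b" if "b \<in> B" for b
      using that x by (simp add: mu0_conj B_def) (simp add: mu0_def)
    then have "c x = Re (\<Sum>b\<in>B. 1)"
      unfolding c_def by (intro arg_cong[where f = Re] sum.cong) (auto simp: B_def mu_unit)
    then show ?thesis by simp
  qed
  \<comment> \<open>After moving the factors from \<open>B\<close> and \<open>K\<close> out by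
    conjugation, \<open>triv\<close> leaves only the term of the identity.\<close>
  have c_x0: "c (b \<otimes> x0 \<otimes> k) = 1" if b: "b \<in> B" and k: "k \<in> K" for b k
  proof -
    have "mu0 (inv (b \<otimes> x0 \<otimes> k) \<otimes> a \<otimes> (b \<otimes> x0 \<otimes> k)) = (if a = \<one> then 1 else 0)"
      if a: "a \<in> B" for a
    proof -
      define a' where "a' = inv b \<otimes> a \<otimes> b"
      have a'B: "a' \<in> B" using a b by (simp add: a'_def)
      have [simp]: "a \<in> carrier G" "b \<in> carrier G" using a b by auto
      have "inv (b \<otimes> x0 \<otimes> k) \<otimes> a \<otimes> (b \<otimes> x0 \<otimes> k) = inv k \<otimes> (inv x0 \<otimes> a' \<otimes> x0) \<otimes> k"
        using k by (simp add: a'_def m_assoc inv_mult_group)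
      then have eq: "mu0 (inv (b \<otimes> x0 \<otimes> k) \<otimes> a \<otimes> (b \<otimes> x0 \<otimes> k)) = mu0 (inv x0 \<otimes> a' \<otimes> x0)"
        using k a'B by (simp add: mu0_conj)
      show ?thesis
      proof (cases "a = \<one>")
        case True
        then have "a' = \<one>" by (simp add: a'_def)
        with eq True show ?thesis by (simp add: mu0_def mu_one)
      next
        case False
        have "a' \<noteq> \<one>"
        proof
          assume "a' = \<one>"
          then have "b \<otimes> a' \<otimes> inv b = \<one>" by simp
          moreover have "b \<otimes> a' \<otimes> inv b = a" by (simp add: a'_def m_assoc)
          ultimately show False using False by simp
        qed
        then have "inv x0 \<otimes> a' \<otimes> x0 \<notin> K" using triv a'B by (auto simp: B_def)
        with eq False show ?thesis by (simp add: mu0_def)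
      qed
    qed
    then have "c (b \<otimes> x0 \<otimes> k) = Re (\<Sum>a\<in>B. if a = \<one> then \<mu> \<one> else 0)"
      unfolding c_def by (intro arg_cong[where f = Re] sum.cong) auto
    then show ?thesis using finB by (simp add: mu_one)
  qed
  \<comment> \<open>The double coset of \<open>x0\<close>. By \<open>triv\<close> its elements are
    written uniquely as \<open>b \<otimes> x0 \<otimes> k\<close>.\<close>
  define X where "X = (\<lambda>(b,k). b \<otimes> x0 \<otimes> k) ` (B \<times> K)"
  have X_sub: "X \<subseteq> carrier G" by (auto simp: X_def)
  have cardX: "card X = card B * card K"
  proof -
    have "inj_on (\<lambda>(b,k). b \<otimes> x0 \<otimes> k) (B \<times> K)"
    proof (rule inj_onI, clarify)
      fix b k b' k' assume *: "b \<in> B" "k \<in> K" "b' \<in> B" "k' \<in> K" and eq: "b \<otimes> x0 \<otimes> k = b' \<otimes> x0 \<otimes> k'"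
      have [simp]: "b \<in> carrier G" "b' \<in> carrier G" using * by auto
      have "inv x0 \<otimes> (inv b' \<otimes> b) \<otimes> x0 = inv x0 \<otimes> inv b' \<otimes> (b \<otimes> x0 \<otimes> k) \<otimes> inv k"
        using * by (simp add: m_assoc)
      also have "\<dots> = k' \<otimes> inv k" unfolding eq using * by (simp add: m_assoc)
      finally have "inv x0 \<otimes> (inv b' \<otimes> b) \<otimes> x0 \<in> K" using * by simp
      moreover have "inv b' \<otimes> b \<in> B" using * by simp
      ultimately have "inv b' \<otimes> b = \<one>" using triv by (simp add: B_def)
      then have "b' \<otimes> (inv b' \<otimes> b) = b'" by simp
      then have bb: "b = b'" by simp
      with eq have "k = k'" using * by (simp add: m_assoc)
      with bb show "b = b' \<and> k = k'" by simp
    qed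
    then show ?thesis by (simp add: X_def card_image card_cartesian_product)
  qed
  have disj: "K \<inter> X = {}"
  proof -
    have "b \<otimes> x0 \<otimes> k \<notin> K" if "b \<in> B" "k \<in> K" for b k
      using that x0 by (simp add: mult_K_iff_right mult_K_iff_left B_def)
    then show ?thesis by (auto simp: X_def)
  qed
  \<comment> \<open>On \<open>K\<close> there are \<open>card K\<close> terms equal to
    \<open>card B\<close>; on \<open>X\<close> there are \<open>card B * card K\<close> terms equal
    to 1. Both double cosets thus carry the same total.\<close>
  have "2 * (real (card B) * real (card K)) = (\<Sum>x\<in>K. c x) + (\<Sum>x\<in>X. c x)"
  proof -
    have "(\<Sum>x\<in>X. c x) = (\<Sum>x\<in>X. 1)" by (rule sum.cong) (auto simp: X_def c_x0)
    then show ?thesis by (simp add: c_K cardX)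
  qed
  also have "\<dots> = (\<Sum>x\<in>K \<union> X. c x)"
    using finite_K finite_subset[OF X_sub finite_carrier] disj by (simp add: sum.union_disjoint)
  also have "\<dots> \<le> (\<Sum>x\<in>carrier G. c x)"
    using finite_carrier X_sub c_nonneg subgroup.subset[OF subgroup_K] by (intro sum_mono2) auto
  finally have ge: "2 * (real (card B) * real (card K)) \<le> (\<Sum>x\<in>carrier G. c x)" .
  have "Re (char_inner G (induced_char G H M.ind) ind)
      = (\<Sum>x\<in>carrier G. c x) / (real (card B) * real (card K))"
    unfolding char_inner_induced[OF H] c_def B_def Re_sum[symmetric] of_nat_mult[symmetric]
    by (rule Re_divide_of_nat)
  also have "\<dots> \<ge> 2" using ge cardB card_K_pos by (simp add: field_simps)
  finally have "\<not> Re (char_inner G (induced_char G H M.ind) ind) \<le> 1" by simp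
  moreover have "irr_char G ind" by (rule irr_char_ind[OF mackey])
  moreover have "irr_char (G\<lparr>carrier := H\<rparr>) M.ind"
    using mackey_H by (intro M.irr_char_ind) auto
  ultimately show ?thesis unfolding strong_gelfand_pair_def by blast
qed

end

section \<open>The symplectic group\<close>

lemma lessThan_4: "{0..<4::nat} = {0, 1, 2, 3}" by auto

lemma less_4_cases: "i < (4::nat) \<Longrightarrow> i = 0 \<or> i = 1 \<or> i = 2 \<or> i = 3" by auto

lemma index_mult_mat4:
  assumes "A \<in> carrier_mat 4 4" "B \<in> carrier_mat 4 4" "i < 4" "j < 4"
  shows "(A * B) $$ (i,j) = A $$ (i,0) * B $$ (0,j) + A $$ (i,1) * B $$ (1,j)
    + A $$ (i,2) * B $$ (2,j) + A $$ (i,3) * B $$ (3,j)"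
  using assms by (simp add: scalar_prod_def lessThan_4 add.assoc)

lemma rows4_carrier [simp]: "mat_of_rows_list 4 [a, b, c, d] \<in> carrier_mat 4 4"
  by (intro carrier_matI) (simp_all add: mat_of_rows_list_def)

lemma mult_carrier_mat4 [simp]:
  "A \<in> carrier_mat 4 4 \<Longrightarrow> B \<in> carrier_mat 4 4 \<Longrightarrow> A * B \<in> carrier_mat 4 4"
  by (rule mult_carrier_mat)

lemma mult_one_mat4 [simp]:
  fixes A :: "'a::semiring_1 mat"
  assumes "A \<in> carrier_mat 4 4"
  shows "1\<^sub>m 4 * A = A" "A * 1\<^sub>m 4 = A"
  by (rule left_mult_one_mat[OF assms], rule right_mult_one_mat[OF assms])

lemmas mult_assoc4 = assoc_mult_mat[of _ 4 4 _ 4 _ 4]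

lemma rows4_dim [simp]:
  "dim_row (mat_of_rows_list 4 [a, b, c, d]) = 4" "dim_col (mat_of_rows_list 4 [a, b, c, d]) = 4"
  by (simp_all add: mat_of_rows_list_def)

lemma rows4_index [simp]:
  "i < 4 \<Longrightarrow> j < 4 \<Longrightarrow> mat_of_rows_list 4 [a, b, c, d] $$ (i,j) = [a, b, c, d] ! i ! j"
  by (simp add: mat_of_rows_list_def)

lemma mat4_eqI:
  assumes "A \<in> carrier_mat 4 4" "B \<in> carrier_mat 4 4"
    and "\<And>i. i \<in> {0,1,2,3} \<Longrightarrow> A $$ (i,0) = B $$ (i,0) \<and> A $$ (i,1) = B $$ (i,1)
      \<and> A $$ (i,2) = B $$ (i,2) \<and> A $$ (i,3) = B $$ (i,3)"
  shows "A = B"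
proof (rule eq_matI)
  fix i j assume "i < dim_row B" "j < dim_col B"
  then have "i < 4" "j < 4" using assms by auto
  then show "A $$ (i,j) = B $$ (i,j)"
    using assms(3)[of i] less_4_cases[of i] less_4_cases[of j] by auto
qed (use assms in auto)

lemma rows4_eqI:
  assumes "a = a'" "b = b'" "c = c'" "d = d'"
  shows "mat_of_rows_list 4 [a, b, c, d] = mat_of_rows_list 4 [a', b', c', d']"
  using assms by simp

text \<open>With this rule an identity between products of explicit matrices splits, through
  \<open>rows4_eqI\<close>, into identities between field elements.\<close>

lemma rows4_mult:
  fixes a0 :: "'a::comm_ring_1"
  shows "mat_of_rows_list 4 [[a0,a1,a2,a3],[b0,b1,b2,b3],[c0,c1,c2,c3],[d0,d1,d2,d3]] *
    mat_of_rows_list 4 [[e0,e1,e2,e3],[f0,f1,f2,f3],[g0,g1,g2,g3],[h0,h1,h2,h3]] =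
    mat_of_rows_list 4
     [[a0*e0+a1*f0+a2*g0+a3*h0, a0*e1+a1*f1+a2*g1+a3*h1, a0*e2+a1*f2+a2*g2+a3*h2, a0*e3+a1*f3+a2*g3+a3*h3],
      [b0*e0+b1*f0+b2*g0+b3*h0, b0*e1+b1*f1+b2*g1+b3*h1, b0*e2+b1*f2+b2*g2+b3*h2, b0*e3+b1*f3+b2*g3+b3*h3],
      [c0*e0+c1*f0+c2*g0+c3*h0, c0*e1+c1*f1+c2*g1+c3*h1, c0*e2+c1*f2+c2*g2+c3*h2, c0*e3+c1*f3+c2*g3+c3*h3],
      [d0*e0+d1*f0+d2*g0+d3*h0, d0*e1+d1*f1+d2*g1+d3*h1, d0*e2+d1*f2+d2*g2+d3*h2, d0*e3+d1*f3+d2*g3+d3*h3]]"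
  by (rule mat4_eqI) (auto simp del: index_mult_mat simp: index_mult_mat4)

lemma rows4_transpose:
  "transpose_mat (mat_of_rows_list 4 [[a0,a1,a2,a3],[b0,b1,b2,b3],[c0,c1,c2,c3],[d0,d1,d2,d3]])
   = mat_of_rows_list 4 [[a0,b0,c0,d0],[a1,b1,c1,d1],[a2,b2,c2,d2],[a3,b3,c3,d3]]"
  by (rule mat4_eqI) (auto simp: mat_of_rows_list_def)

lemma one_mat4: "1\<^sub>m 4 = mat_of_rows_list 4 [[1,0,0,0],[0,1,0,0],[0,0,1,0],[0,0,0,1]]"
  by (rule mat4_eqI) auto

lemma J4_rows: "J4 = mat_of_rows_list 4 [[0,0,0,1],[0,0,1,0],[0,-1,0,0],[-1,0,0,0]]"
  by (rule mat4_eqI) (auto simp: J4_def)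

lemma uminus_J4_rows: "- J4 = mat_of_rows_list 4 [[0,0,0,-1],[0,0,-1,0],[0,1,0,0],[1,0,0,0]]"
  by (rule mat4_eqI) (auto simp: J4_rows)

lemma J4_carrier [simp]: "J4 \<in> carrier_mat 4 4"
  by (simp add: J4_def)

lemma Sp4_simps [simp]:
  "x \<otimes>\<^bsub>Sp4\<^esub> y = x * y" "\<one>\<^bsub>Sp4\<^esub> = 1\<^sub>m 4"
  by (simp_all add: Sp4_def)

lemma Sp4_carrier_mat: "A \<in> carrier Sp4 \<Longrightarrow> A \<in> carrier_mat 4 4"
  by (simp add: Sp4_def)

lemma Sp4_form: "A \<in> carrier Sp4 \<Longrightarrow> transpose_mat A * J4 * A = J4"
  by (simp add: Sp4_def)

lemma Sp4_group: "group (Sp4 :: 'a::field mat monoid)"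
proof (rule groupI)
  fix A B :: "'a mat" assume AB: "A \<in> carrier Sp4" "B \<in> carrier Sp4"
  note [simp] = AB[THEN Sp4_carrier_mat]
  have "transpose_mat (A * B) * J4 * (A * B) = transpose_mat B * (transpose_mat A * J4 * A) * B"
    by (simp add: transpose_mult[of A 4 4 B 4] mult_assoc4)
  also have "\<dots> = J4" by (simp only: AB[THEN Sp4_form])
  finally have "transpose_mat (A * B) * J4 * (A * B) = J4" .
  then show "A \<otimes>\<^bsub>Sp4\<^esub> B \<in> carrier Sp4"
    using AB by (simp add: Sp4_def)
next
  show "\<one>\<^bsub>Sp4\<^esub> \<in> carrier (Sp4 :: 'a mat monoid)" by (simp add: Sp4_def)
next
  fix A :: "'a mat" assume A: "A \<in> carrier Sp4"
  note [simp] = Sp4_carrier_mat[OF A]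
  have JJ: "(- J4) * J4 = (1\<^sub>m 4 :: 'a mat)"
    unfolding uminus_J4_rows unfolding J4_rows rows4_mult one_mat4 by simp
  \<comment> \<open>As \<open>- J4\<close> is the inverse of \<open>J4\<close>, multiplying the
    invariance of the form by it on the left exhibits this left inverse of \<open>A\<close>.\<close>
  define X where "X = (- J4) * (transpose_mat A * J4)"
  have X [simp]: "X \<in> carrier_mat 4 4" by (simp add: X_def)
  have XA: "X * A = 1\<^sub>m 4"
    unfolding X_def using JJ Sp4_form[OF A]
    by (subst mult_assoc4) auto
  then have AX: "A * X = 1\<^sub>m 4" by (intro mat_mult_left_right_inverse[OF X]) auto
  \<comment> \<open>The inner \<open>J4\<close> is replaced by
    \<open>transpose_mat A * J4 * A\<close>, and \<open>A * X = 1\<^sub>m 4\<close> then collapses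
    both sides.\<close>
  have "transpose_mat X * J4 * X = transpose_mat X * (transpose_mat A * J4 * A) * X"
    by (simp add: Sp4_form[OF A])
  also have "\<dots> = transpose_mat (A * X) * J4 * (A * X)"
    by (simp add: transpose_mult[of A 4 4 X 4] mult_assoc4)
  also have "\<dots> = J4" unfolding AX by simp
  finally show "\<exists>y\<in>carrier Sp4. y \<otimes>\<^bsub>Sp4\<^esub> A = \<one>\<^bsub>Sp4\<^esub>"
    using XA by (intro bexI[of _ X]) (auto simp: Sp4_def)
qed (auto simp: mult_assoc4 dest!: Sp4_carrier_mat)

lemma finite_carrier_mat: "finite (carrier_mat m n :: 'a::finite mat set)"
proof (rule finite_subset)
  show "carrier_mat m n \<subseteq> mat m n ` (({0..<m} \<times> {0..<n}) \<rightarrow>\<^sub>E (UNIV :: 'a set))"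
    (is "_ \<subseteq> ?f ` _")
  proof
    fix A :: "'a mat" assume A: "A \<in> carrier_mat m n"
    then have "A = mat m n (restrict (($$) A) ({0..<m} \<times> {0..<n}))"
      by (intro eq_matI) auto
    then show "A \<in> ?f ` (({0..<m} \<times> {0..<n}) \<rightarrow>\<^sub>E UNIV)"
      by (intro image_eqI[of _ _ "restrict (($$) A) ({0..<m} \<times> {0..<n})"]) auto
  qed
qed (auto intro!: finite_PiE)

lemma Sp4_finite: "finite (carrier (Sp4 :: 'a::{field, finite} mat monoid))"
  by (rule finite_subset[OF _ finite_carrier_mat[of 4 4]]) (auto simp: Sp4_def)

section \<open>The stabilizer of the line through e_4\<close>

definition pt_stab :: "'a::field mat set" where
  "pt_stab = {A \<in> carrier Sp4. A $$ (0,3) = 0 \<and> A $$ (1,3) = 0 \<and> A $$ (2,3) = 0}"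

lemma pt_stab_Sp4: "A \<in> pt_stab \<Longrightarrow> A \<in> carrier Sp4"
  by (simp add: pt_stab_def)

text \<open>Column 3 is the image of e_4, which \<open>B\<close> scales by its entry (3,3). That
  entry is therefore multiplicative on \<open>pt_stab\<close>, which is what makes it a source of
  linear characters.\<close>

lemma pt_stab_mult_index:
  assumes "A \<in> carrier_mat 4 4" "B \<in> pt_stab" "i < 4"
  shows "(A * B) $$ (i,3) = A $$ (i,3) * B $$ (3,3)"
  using assms by (simp add: pt_stab_def index_mult_mat4 Sp4_carrier_mat del: index_mult_mat)

lemma Sp4_inv:
  assumes "A \<in> carrier Sp4"
  shows "inv\<^bsub>Sp4\<^esub> A \<in> carrier_mat 4 4" "inv\<^bsub>Sp4\<^esub> A * A = 1\<^sub>m 4" "A * inv\<^bsub>Sp4\<^esub> A = 1\<^sub>m 4"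
  using group.inv_closed[OF Sp4_group assms] group.l_inv[OF Sp4_group assms]
    group.r_inv[OF Sp4_group assms] Sp4_carrier_mat by auto

lemma pt_stab_nonzero:
  assumes "A \<in> pt_stab"
  shows "A $$ (3,3) \<noteq> 0"
  using pt_stab_mult_index[OF Sp4_inv(1) assms, of A 3] Sp4_inv(2)[of A] pt_stab_Sp4[OF assms]
  by auto

lemma pt_stab_subgroup: "subgroup pt_stab (Sp4 :: 'a::field mat monoid)"
proof (rule group.subgroupI[OF Sp4_group])
  show "pt_stab \<subseteq> carrier (Sp4 :: 'a mat monoid)" by (auto simp: pt_stab_def)
  have "1\<^sub>m 4 \<in> (pt_stab :: 'a mat set)"
    using group.is_monoid[OF Sp4_group, THEN monoid.one_closed] by (simp add: pt_stab_def)
  then show "pt_stab \<noteq> ({} :: 'a mat set)" by auto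
next
  fix A :: "'a mat" assume A: "A \<in> pt_stab"
  note AS = pt_stab_Sp4[OF A]
  have "(inv\<^bsub>Sp4\<^esub> A) $$ (i,3) * A $$ (3,3) = 1\<^sub>m 4 $$ (i,3)" if "i < 4" for i
    using pt_stab_mult_index[OF Sp4_inv(1)[OF AS] A that] Sp4_inv(2)[OF AS] by simp
  from this[of 0] this[of 1] this[of 2] show "inv\<^bsub>Sp4\<^esub> A \<in> pt_stab"
    using group.inv_closed[OF Sp4_group AS] pt_stab_nonzero[OF A] by (simp add: pt_stab_def)
next
  fix A B :: "'a mat" assume AB: "A \<in> pt_stab" "B \<in> pt_stab"
  have "A \<otimes>\<^bsub>Sp4\<^esub> B \<in> carrier Sp4"
    by (intro monoid.m_closed[OF group.is_monoid[OF Sp4_group]] pt_stab_Sp4 AB)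
  then show "A \<otimes>\<^bsub>Sp4\<^esub> B \<in> pt_stab"
    using pt_stab_mult_index[OF Sp4_carrier_mat[OF pt_stab_Sp4[OF AB(1)]] AB(2)] AB(1)
    by (simp add: pt_stab_def del: index_mult_mat)
qed

text \<open>The hypothesis says that the image of e_4 under \<open>g\<close> is an eigenvector of
  \<open>k\<close>, so the conjugate of \<open>k\<close> by \<open>g\<close> has e_4 as an
  eigenvector with the same eigenvalue. Mackey's condition becomes a search for a \<open>k\<close>
  with prescribed eigenvectors.\<close>

lemma pt_stab_conj:
  assumes g: "g \<in> carrier Sp4" and k: "k \<in> carrier Sp4"
    and eig: "\<And>i. i < 4 \<Longrightarrow> (k * g) $$ (i,3) = s * g $$ (i,3)"
  shows "\<exists>k'\<in>pt_stab. k * g = g * k' \<and> k' $$ (3,3) = s"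
proof -
  interpret group "Sp4 :: 'a mat monoid" by (rule Sp4_group)
  define X where "X = inv\<^bsub>Sp4\<^esub> g"
  have X: "X \<in> carrier Sp4" "X \<in> carrier_mat 4 4" "X * g = 1\<^sub>m 4" "g * X = 1\<^sub>m 4"
    using g Sp4_inv[OF g] by (auto simp: X_def)
  note [simp] = X(2) g[THEN Sp4_carrier_mat] k[THEN Sp4_carrier_mat]
  define k' where "k' = X * (k * g)"
  have col: "k' $$ (i,3) = s * 1\<^sub>m 4 $$ (i,3)" if "i < 4" for i
  proof -
    have "k' $$ (i,3) = s * (X * g) $$ (i,3)"
      using that by (simp add: k'_def index_mult_mat4[of X] eig algebra_simps del: index_mult_mat)
    then show ?thesis by (simp add: X)
  qed
  have "k' \<in> carrier Sp4" using m_closed[OF X(1) m_closed[OF k g]] by (simp add: k'_def)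
  then have "k' \<in> pt_stab" using col by (simp add: pt_stab_def)
  moreover have "g * k' = k * g"
    unfolding k'_def by (simp add: mult_assoc4[symmetric] X)
  moreover have "k' $$ (3,3) = s" using col[of 3] by simp
  ultimately show ?thesis by metis
qed

section \<open>Characteristic two\<close>

locale suzuki_field =
  fixes n :: nat and F :: "'a::{field, finite} itself"
  assumes card_field: "card (UNIV :: 'a set) = 2 ^ (2 * n + 1)"
begin

lemma two [simp]: "(2 :: 'a) = 0"
  by (rule char_two_of_even_card) (simp add: card_field)

text \<open>As rewrite rules these erase signs and cancel repeated summands, so that ring
  normalization can decide the matrix identities below.\<close>

lemma char2 [simp]: "x + x = (0::'a)" "x + (x + y) = (y::'a)" "- x = (x::'a)" "x - y = x + (y::'a)"
proof -
  show xx: "x + x = (0::'a)" for x using two by (metis mult_2 mult_zero_left)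
  then show mx: "- x = x" for x :: 'a by (metis minus_unique)
  show "x + (x + y) = (y::'a)" by (simp add: add.assoc[symmetric] xx)
  show "x - y = x + (y::'a)" by (metis mx diff_conv_add_uminus)
qed

lemma add_eq_0 [simp]: "x + y = 0 \<longleftrightarrow> x = (y::'a)"
  by (metis char2(3) add_eq_0_iff)

lemma power_two_add: "((x::'a) + y) ^ (2 ^ k) = x ^ (2 ^ k) + y ^ (2 ^ k)"
proof (induction k)
  case (Suc k)
  have sq: "(u + v)\<^sup>2 = u\<^sup>2 + v\<^sup>2" for u v :: 'a
    by (simp add: power2_sum two)
  have "z ^ 2 ^ Suc k = (z ^ 2 ^ k)\<^sup>2" for z :: 'a
    by (simp add: power_mult[symmetric] mult.commute)
  then show ?case by (simp add: Suc sq)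
qed simp

text \<open>The witness \<open>k\<close> has both e_4 and the last column of \<open>g\<close> as
  eigenvectors. If these are not orthogonal, their eigenvalues are inverse to each other; otherwise
  1 and \<open>s\<close> are possible. A character \<open>\<nu>\<close> with
  \<open>\<nu> s * \<nu> s \<noteq> 1\<close> separates the eigenvalues in either case.\<close>

lemma Sp4_mackey:
  fixes g :: "'a mat"
  assumes g: "g \<in> carrier Sp4" "g \<notin> pt_stab" and s: "s \<noteq> 0"
  shows "\<exists>k\<in>pt_stab. \<exists>k'\<in>pt_stab. k * g = g * k' \<and>
    (k $$ (3,3) = s \<and> k' $$ (3,3) = inverse s \<or> k $$ (3,3) = 1 \<and> k' $$ (3,3) = s)"
proof -
  note [simp] = g(1)[THEN Sp4_carrier_mat]
  define r where "r = inverse s"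
  have rs: "r * s = 1" "s * r = 1" using s by (simp_all add: r_def)
  have rs' [simp]: "r * (s * x) = x" "s * (r * x) = x" for x
    using rs by (simp_all add: mult.assoc[symmetric])
  define c where "c i = g $$ (i,3)" for i
  consider "c 0 \<noteq> 0" | "c 0 = 0" "c 1 \<noteq> 0" | "c 0 = 0" "c 1 = 0" "c 2 \<noteq> 0"
    using g by (auto simp: pt_stab_def c_def)
  then show ?thesis
  proof cases
    case 1
    \<comment> \<open>\<open>k\<close> scales \<open>e\<^sub>4\<close> by \<open>s\<close> and the last column of \<open>g\<close> by \<open>r\<close>, and fixes their orthogonal complement.\<close>
    define u where "u i = c i / c 0" for i
    have cu: "g $$ (i,3) = g $$ (0,3) * u i" for i using 1 by (simp add: u_def c_def)
    define k where "k = mat_of_rows_list 4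
      [[r, 0, 0, 0],
       [(r + 1) * u 1, 1, 0, 0],
       [(r + 1) * u 2, 0, 1, 0],
       [(r + s) * u 3, (s + 1) * u 2, (s + 1) * u 1, s]]"
    have k: "k \<in> carrier Sp4"
      unfolding Sp4_def k_def J4_rows
      by (simp add: rows4_mult rows4_transpose, rule rows4_eqI)
        (simp_all add: algebra_simps rs)
    have "(k * g) $$ (i,3) = r * g $$ (i,3)" if "i < 4" for i
      using less_4_cases[OF that]
      by (auto simp: k_def index_mult_mat4 cu[of "Suc 0"] cu[of 2] cu[of 3] algebra_simps
          simp del: index_mult_mat)
    from pt_stab_conj[OF g(1) k this] obtain k' where
      "k' \<in> pt_stab" "k * g = g * k'" "k' $$ (3,3) = r" by blast
    moreover have "k \<in> pt_stab" "k $$ (3,3) = s" using k by (simp_all add: pt_stab_def k_def)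
    ultimately show ?thesis unfolding r_def by blast
  next
    case 2
    \<comment> \<open>The last column of \<open>g\<close> is orthogonal to \<open>e\<^sub>4\<close> but not to \<open>e\<^sub>3\<close>: \<open>k\<close> scales it by \<open>s\<close> and
      \<open>e\<^sub>3\<close> by \<open>r\<close>, and fixes the orthogonal complement of the two, which contains \<open>e\<^sub>4\<close>.\<close>
    define u where "u i = c i / c 1" for i
    have cu: "g $$ (i,3) = g $$ (1,3) * u i" for i using 2 by (simp add: u_def c_def)
    define k where "k = mat_of_rows_list 4
      [[1, 0, 0, 0],
       [0, s, 0, 0],
       [(r + 1) * u 3, (r + s) * u 2, r, 0],
       [0, (s + 1) * u 3, 0, 1]]"
    have k: "k \<in> carrier Sp4"
      unfolding Sp4_def k_def J4_rows
      by (simp add: rows4_mult rows4_transpose, rule rows4_eqI)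
        (simp_all add: algebra_simps rs)
    have "(k * g) $$ (i,3) = s * g $$ (i,3)" if "i < 4" for i
      using less_4_cases[OF that] 2
      by (auto simp: k_def index_mult_mat4 c_def cu[of 2] cu[of 3] algebra_simps
          simp del: index_mult_mat)
    from pt_stab_conj[OF g(1) k this] obtain k' where
      "k' \<in> pt_stab" "k * g = g * k'" "k' $$ (3,3) = s" by blast
    moreover have "k \<in> pt_stab" "k $$ (3,3) = 1" using k by (simp_all add: pt_stab_def k_def)
    ultimately show ?thesis by blast
  next
    case 3
    \<comment> \<open>The last column of \<open>g\<close> lies in the span of e_3 and e_4 but off
      the line of e_4. Here \<open>k\<close> scales it by \<open>s\<close> and e_2 by
      \<open>r\<close>, and fixes the orthogonal complement of the two, which contains e_4.\<close>
    define u where "u i = c i / c 2" for i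
    have cu: "g $$ (i,3) = g $$ (2,3) * u i" for i using 3 by (simp add: u_def c_def)
    define k where "k = mat_of_rows_list 4
      [[1, 0, 0, 0],
       [(r + 1) * u 3, r, 0, 0],
       [0, 0, s, 0],
       [0, 0, (s + 1) * u 3, 1]]"
    have k: "k \<in> carrier Sp4"
      unfolding Sp4_def k_def J4_rows
      by (simp add: rows4_mult rows4_transpose, rule rows4_eqI)
        (simp_all add: algebra_simps rs)
    have "(k * g) $$ (i,3) = s * g $$ (i,3)" if "i < 4" for i
      using less_4_cases[OF that] 3
      by (auto simp: k_def index_mult_mat4 c_def cu[of 3] algebra_simps
          simp del: index_mult_mat)
    from pt_stab_conj[OF g(1) k this] obtain k' where
      "k' \<in> pt_stab" "k * g = g * k'" "k' $$ (3,3) = s" by blast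
    moreover have "k \<in> pt_stab" "k $$ (3,3) = 1" using k by (simp_all add: pt_stab_def k_def)
    ultimately show ?thesis by blast
  qed
qed

section \<open>The Bruhat decomposition of the Suzuki group\<close>

abbreviation T :: "'a \<Rightarrow> 'a \<Rightarrow> 'a mat" where "T \<equiv> sz_T n"
abbreviation D :: "'a \<Rightarrow> 'a mat" where "D \<equiv> sz_D n"
abbreviation W :: "'a mat" where "W \<equiv> sz_W"

text \<open>\<open>t\<close> is the square root of the Frobenius automorphism, and \<open>p\<close> is its inverse.\<close>

definition t :: "'a \<Rightarrow> 'a" where "t x = x ^ (2 ^ (n + 1))"
definition p :: "'a \<Rightarrow> 'a" where "p x = x ^ (2 ^ n)"

lemma t_add [simp]: "t (x + y) = t x + t y"
  unfolding t_def by (rule power_two_add)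

lemma t_mult [simp]: "t (x * y) = t x * t y"
  by (simp add: t_def power_mult_distrib)

lemma p_mult [simp]: "p (x * y) = p x * p y"
  by (simp add: p_def power_mult_distrib)

lemma t_inverse [simp]: "t (inverse x) = inverse (t x)"
  by (simp add: t_def power_inverse)

lemma p_inverse [simp]: "p (inverse x) = inverse (p x)"
  by (simp add: p_def power_inverse)

lemma t_0 [simp]: "t 0 = 0" and t_1 [simp]: "t 1 = 1" and p_1 [simp]: "p 1 = 1"
  by (simp_all add: t_def p_def)

lemma t_eq_0 [simp]: "t x = 0 \<longleftrightarrow> x = 0" and p_eq_0 [simp]: "p x = 0 \<longleftrightarrow> x = 0"
  by (simp_all add: t_def p_def)

lemma power_q: "(x::'a) ^ (2 ^ (2 * n + 1)) = x"
  using finite_field_power_card[of x] by (simp add: card_field)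

lemma t_t [simp]: "t (t x) = x * x"
proof -
  have "t (t x) = x ^ (2 ^ (n + 1) * 2 ^ (n + 1))"
    unfolding t_def by (rule power_mult[symmetric])
  also have "(2::nat) ^ (n + 1) * 2 ^ (n + 1) = 2 ^ (2 * n + 1) * 2"
    by (simp add: mult_2 mult_2_right power_add distrib_left distrib_right)
  finally show ?thesis by (simp only: power_mult power_q power2_eq_square)
qed

lemma t_p [simp]: "t (p x) = x" and p_t [simp]: "p (t x) = x"
proof -
  have *: "(2::nat) ^ n * 2 ^ (n + 1) = 2 ^ (2 * n + 1)"
    by (simp add: mult_2 mult_2_right power_add distrib_left distrib_right)
  then have "t (p x) = x ^ (2 ^ (2 * n + 1))" unfolding t_def p_def by (metis power_mult)
  then show "t (p x) = x" by (simp only: power_q)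
  from * have "p (t x) = x ^ (2 ^ (2 * n + 1))" unfolding t_def p_def
    by (metis power_mult mult.commute)
  then show "p (t x) = x" by (simp only: power_q)
qed

lemma p_sq: "p x * p x = t x"
  by (simp add: p_def t_def power_add[symmetric] mult_2)

lemma T_rows: "T a b = mat_of_rows_list 4
  [[1, 0, 0, 0], [a, 1, 0, 0], [b, t a, 1, 0], [a * a * t a + a * b + t b, a * t a + b, a, 1]]"
  by (simp add: sz_T_def t_def power2_eq_square)

lemma D_rows: "D l = mat_of_rows_list 4
  [[l * p l, 0, 0, 0], [0, p l, 0, 0], [0, 0, p (inverse l), 0], [0, 0, 0, inverse l * p (inverse l)]]"
  by (simp add: sz_D_def p_def power_inverse)

lemma carriers [simp]: "T a b \<in> carrier_mat 4 4" "D l \<in> carrier_mat 4 4" "W \<in> carrier_mat 4 4"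
  unfolding T_rows D_rows sz_W_def by simp_all

text \<open>Together with the relations for \<open>D\<close> and \<open>W\<close> that follow, this
  lets products of generators be sorted into the normal forms of the Bruhat decomposition.\<close>

lemma T_mult_T: "T a b * T c d = T (a + c) (b + d + t a * c)"
  unfolding T_rows rows4_mult by (rule rows4_eqI) (simp_all add: algebra_simps)

lemma D_mult_D: "D k * D l = D (k * l)"
  unfolding D_rows rows4_mult by (rule rows4_eqI) (simp_all add: algebra_simps)

lemma D_mult_T:
  assumes "l \<noteq> 0"
  shows "D l * T a b = T (inverse l * a) (inverse l * t (inverse l) * b) * D l"
proof -
  define m pl pm where "m = inverse l" and "pl = p l" and "pm = p m"
  have lm: "l * m = 1" "m * l = 1" "pl * pm = 1" "pm * pl = 1"
    using assms by (simp_all add: m_def pl_def pm_def)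
  then have lm': "l * (m * x) = x" "m * (l * x) = x" "pl * (pm * x) = x" "pm * (pl * x) = x" for x
    by (simp_all add: mult.assoc[symmetric])
  have "t m = pm * pm" "t pm = m" by (simp_all add: pm_def p_sq)
  then show ?thesis
    unfolding T_rows D_rows rows4_mult m_def[symmetric] pl_def[symmetric] pm_def[symmetric]
    by (intro rows4_eqI) (simp_all add: algebra_simps lm lm')
qed

lemma W_mult_D: "W * D l = D (inverse l) * W"
  unfolding sz_W_def D_rows rows4_mult by (rule rows4_eqI) simp_all

lemma W_mult_W: "W * W = 1\<^sub>m 4"
  unfolding sz_W_def rows4_mult one_mat4 by (rule rows4_eqI) simp_all

lemma T_zero: "T 0 0 = 1\<^sub>m 4"
  unfolding T_rows one_mat4 by (rule rows4_eqI) simp_all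

lemma D_one: "D 1 = 1\<^sub>m 4"
  unfolding D_rows one_mat4 by (rule rows4_eqI) simp_all

lemma T_mult_D:
  assumes "l \<noteq> 0"
  shows "T a b * D l = D l * T (l * a) (l * t l * b)"
  unfolding D_mult_T[OF assms] using assms by (simp add: algebra_simps)

text \<open>The lower left entry of \<open>T a b\<close>. It is the function whose graph describes
  the affine part of the Suzuki-Tits ovoid.\<close>

definition N :: "'a \<Rightarrow> 'a \<Rightarrow> 'a" where "N a b = a * a * t a + a * b + t b"

lemma t_N: "t (N a b) = a * a * t a * t a + t a * t b + b * b"
  by (simp add: N_def algebra_simps)

lemma N_eq_0: "N a b = 0 \<longleftrightarrow> a = 0 \<and> b = 0"
proof
  assume N: "N a b = 0"
  \<comment> \<open>Every summand on the right contains \<open>N a b\<close> or its image under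
    \<open>t\<close>, so all of them vanish.\<close>
  have "b * b * t b = N a b * t (N a b) + a * b * t (N a b) + t a * N a b * N a b"
    unfolding t_N unfolding N_def by (simp add: algebra_simps)
  with N have "b = 0" by simp
  with N show "a = 0 \<and> b = 0" by (simp add: N_def)
qed (simp add: N_def)

text \<open>The relation that keeps the two cells closed under products. It rests on
  \<open>N_eq_0\<close>: the upper right entry of the left side is \<open>N a b\<close>, which must
  be invertible.\<close>

lemma W_T_W:
  assumes "a \<noteq> 0 \<or> b \<noteq> 0"
  shows "\<exists>c d l e f. l \<noteq> 0 \<and> W * (T a b * W) = T c d * (D l * (W * T e f))"
proof -
  define A x1 x2 y1 y2 where "A = t a" and "x1 = N a b" and "x2 = inverse x1"
    and "y1 = t x1" and "y2 = inverse y1"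
  have nz: "x1 \<noteq> 0" "y1 \<noteq> 0" using assms by (auto simp: x1_def y1_def N_eq_0)
  then have inv: "x1 * x2 = 1" "x2 * x1 = 1" "y1 * y2 = 1" "y2 * y1 = 1"
    by (simp_all add: x2_def y2_def)
  then have cancel: "x1 * (x2 * z) = z" "x2 * (x1 * z) = z" "y1 * (y2 * z) = z" "y2 * (y1 * z) = z" for z
    by (simp_all add: mult.assoc[symmetric])
  have tA: "t a = A" "t A = a * a" by (simp_all add: A_def)
  have tb: "t b = x1 + a * a * A + a * b" by (simp add: x1_def N_def A_def algebra_simps)
  \<comment> \<open>With \<open>tb\<close>, \<open>bb\<close> and \<open>cancel\<close> as rewrite rules, every entry has a normal form in which
    \<open>b\<close> occurs at most to the first power.\<close>
  have bb: "b * b = y1 + A * x1 + a * b * A"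
    by (simp add: y1_def x1_def t_N N_def tA algebra_simps)
  then have bb': "b * (b * z) = y1 * z + A * x1 * z + a * b * A * z" for z
    by (simp add: mult.assoc[symmetric] distrib_right)
  have tx: "t x1 = y1" "t x2 = y2" "t y1 = x1 * x1" "t y2 = x2 * x2"
    by (simp_all add: x2_def y2_def y1_def)
  \<comment> \<open>The upper right entry of the right side is \<open>l * p l\<close>. Equating it
    with \<open>x1\<close>, squaring and using \<open>p_sq\<close> forces this value of
    \<open>l\<close>.\<close>
  define l where "l = x1 * x1 * y2"
  have "inverse (p x1) * inverse (p x1) = inverse (t x1)"
    by (simp flip: p_sq)
  then have pl: "p l = y1 * x2" "p (inverse l) = x1 * y2" "inverse l = x2 * x2 * y1"
    by (simp_all add: l_def p_sq x2_def y2_def y1_def mult.commute)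
  have D: "D l = mat_of_rows_list 4
      [[x1, 0, 0, 0], [0, y1 * x2, 0, 0], [0, 0, x1 * y2, 0], [0, 0, 0, x2]]"
    unfolding D_rows pl(1,2) unfolding pl(3)
    by (intro rows4_eqI) (simp_all add: l_def algebra_simps cancel inv)
  have "l \<noteq> 0" using nz by (simp add: l_def y2_def)
  \<comment> \<open>Comparing last columns yields the parameters of the left factor
    \<open>T\<close>; comparing first rows yields those of the right one.\<close>
  moreover have "W * (T a b * W) = T (b * x2) (a * x2) *
      (D l * (W * T ((a * A + b) * x2) (b * y2)))"
    unfolding T_rows D sz_W_def rows4_mult t_mult t_add tA tb tx
    by (rule rows4_eqI) (simp_all add: algebra_simps cancel inv bb bb')
  ultimately show ?thesis by blast
qed

section \<open>The Borel subgroup \<open>cell\<close>, the cell \<open>big_cell\<close>, and closure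
  of their union under products\<close>

definition cell :: "'a mat set" where
  "cell = {T a b * D l | a b l. l \<noteq> 0}"

definition big_cell :: "'a mat set" where
  "big_cell = {T a b * (D l * (W * T c d)) | a b l c d. l \<noteq> 0}"

lemma cellI: "l \<noteq> 0 \<Longrightarrow> T a b * D l \<in> cell"
  by (auto simp: cell_def)

lemma big_cellI: "l \<noteq> 0 \<Longrightarrow> T a b * (D l * (W * T c d)) \<in> big_cell"
  unfolding big_cell_def by blast

lemma bruhat_cases:
  assumes "X \<in> cell \<union> big_cell"
  obtains a b l where "l \<noteq> 0" "X = T a b * D l"
  | a b l c d where "l \<noteq> 0" "X = T a b * (D l * (W * T c d))"
  using assms unfolding cell_def big_cell_def by blast

text \<open>The relations with a trailing factor \<open>X\<close>, so that they apply inside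
  products nested to the right.\<close>

lemma assoc_rewrites:
  assumes "X \<in> carrier_mat 4 4"
  shows "T a b * (T c d * X) = T (a + c) (b + d + t a * c) * X"
    "D k * (D l * X) = D (k * l) * X"
    "l \<noteq> 0 \<Longrightarrow> D l * (T a b * X) = T (inverse l * a) (inverse l * t (inverse l) * b) * (D l * X)"
    "W * (D l * X) = D (inverse l) * (W * X)"
    "W * (W * X) = X"
  using assms
  by (simp_all add: mult_assoc4[symmetric] T_mult_T D_mult_D D_mult_T W_mult_D W_mult_W)

lemma T_mult_bruhat:
  assumes "X \<in> cell \<union> big_cell"
  shows "T a b * X \<in> cell \<union> big_cell"
  using assms
proof (cases rule: bruhat_cases)
  case 1
  then show ?thesis by (auto simp: assoc_rewrites intro!: cellI)
next
  case 2
  then show ?thesis by (auto simp: assoc_rewrites intro!: big_cellI)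
qed

lemma D_mult_bruhat:
  assumes "X \<in> cell \<union> big_cell" "k \<noteq> 0"
  shows "D k * X \<in> cell \<union> big_cell"
  using assms(1)
proof (cases rule: bruhat_cases)
  case 1
  with assms(2) have "D k * X \<in> cell" by (auto simp: assoc_rewrites D_mult_D intro!: cellI)
  then show ?thesis by simp
next
  case 2
  with assms(2) have "D k * X \<in> big_cell" by (auto simp: assoc_rewrites intro!: big_cellI)
  then show ?thesis by simp
qed

lemma cells_T_D: "T a b \<in> cell" "l \<noteq> 0 \<Longrightarrow> D l \<in> cell"
  using cellI[of 1 a b] cellI[of l 0 0] by (simp_all add: D_one T_zero)

text \<open>\<open>W\<close> passes through \<open>D\<close> by inverting its parameter, so only
  \<open>W * T * W\<close> has to be rewritten. \<open>W_T_W\<close> does this unless the middle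
  factor is trivial, and then the two copies of \<open>W\<close> cancel.\<close>

lemma W_mult_bruhat:
  assumes "X \<in> cell \<union> big_cell"
  shows "W * X \<in> cell \<union> big_cell"
  using assms
proof (cases rule: bruhat_cases)
  case (1 a b l)
  then have "W * X = D (inverse l) * (W * T (l * a) (l * t l * b))"
    by (simp add: T_mult_D assoc_rewrites)
  also have "\<dots> = T 0 0 * \<dots>" by (simp add: T_zero)
  finally have "W * X \<in> big_cell" using 1(1) by (simp only:) (rule big_cellI, simp)
  then show ?thesis by simp
next
  case (2 a b l c d)
  define a' b' where "a' = l * a" and "b' = l * t l * b"
  have "X = D l * (T a' b' * (W * T c d))"
    using 2 by (simp add: mult_assoc4[symmetric] T_mult_D a'_def b'_def)
  then have WX: "W * X = D (inverse l) * (W * (T a' b' * (W * T c d)))"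
    by (simp add: assoc_rewrites)
  have "W * (T a' b' * (W * T c d)) \<in> cell \<union> big_cell"
  proof (cases "a' = 0 \<and> b' = 0")
    case True
    then have "W * (T a' b' * (W * T c d)) = T c d" by (simp add: T_zero assoc_rewrites)
    then show ?thesis using cells_T_D by simp
  next
    case False
    then obtain e f k g h where k: "k \<noteq> 0"
      "W * (T a' b' * W) = T e f * (D k * (W * T g h))" using W_T_W[of a' b'] by blast
    have "W * (T a' b' * (W * T c d)) = W * (T a' b' * W) * T c d"
      by (simp add: mult_assoc4)
    also have "\<dots> = T e f * (D k * (W * T (g + c) (h + d + t g * c)))"
      unfolding k(2) by (simp add: mult_assoc4 T_mult_T)
    finally show ?thesis using k(1) by (simp add: big_cellI)
  qed
  then show ?thesis unfolding WX using 2(1) by (intro D_mult_bruhat) auto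
qed

lemma bruhat_mult:
  assumes "X \<in> cell \<union> big_cell" "Y \<in> cell \<union> big_cell"
  shows "X * Y \<in> cell \<union> big_cell"
proof -
  have Y [simp]: "Y \<in> carrier_mat 4 4"
    using assms(2) by (cases rule: bruhat_cases) auto
  show ?thesis using assms(1)
  proof (cases rule: bruhat_cases)
    case (1 a b l)
    have "X * Y = T a b * (D l * Y)" unfolding 1(2) by (simp add: mult_assoc4)
    then show ?thesis using 1(1) assms(2) T_mult_bruhat D_mult_bruhat by simp
  next
    case (2 a b l c d)
    have "X * Y = T a b * (D l * (W * (T c d * Y)))" unfolding 2(2) by (simp add: mult_assoc4)
    then show ?thesis
      using 2(1) assms(2) T_mult_bruhat D_mult_bruhat W_mult_bruhat by simp
  qed
qed

section \<open>The Suzuki group and its intersection with the point stabilizer\<close>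

lemma generators_Sp4:
  "T a b \<in> carrier Sp4" "l \<noteq> 0 \<Longrightarrow> D l \<in> carrier Sp4" "W \<in> carrier Sp4"
proof -
  show "T a b \<in> carrier Sp4"
    unfolding Sp4_def T_rows J4_rows
    by (simp add: rows4_mult rows4_transpose algebra_simps)
  show "W \<in> carrier Sp4"
    unfolding Sp4_def sz_W_def J4_rows by (simp add: rows4_mult rows4_transpose)
  assume "l \<noteq> 0"
  then show "D l \<in> carrier Sp4"
    unfolding Sp4_def D_rows J4_rows
    by (simp add: rows4_mult rows4_transpose, intro rows4_eqI) (simp_all add: field_simps)
qed

lemma inv_generators:
  "inv\<^bsub>Sp4\<^esub> (T a b) = T a (b + t a * a)" "l \<noteq> 0 \<Longrightarrow> inv\<^bsub>Sp4\<^esub> (D l) = D (inverse l)"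
  "inv\<^bsub>Sp4\<^esub> W = W"
proof -
  interpret group "Sp4 :: 'a mat monoid" by (rule Sp4_group)
  show "inv\<^bsub>Sp4\<^esub> (T a b) = T a (b + t a * a)"
    by (rule inv_equality) (simp_all add: T_mult_T T_zero generators_Sp4 algebra_simps)
  show "inv\<^bsub>Sp4\<^esub> W = W"
    by (rule inv_equality) (simp_all add: W_mult_W generators_Sp4)
  assume "l \<noteq> 0"
  then show "inv\<^bsub>Sp4\<^esub> (D l) = D (inverse l)"
    by (intro inv_equality) (simp_all add: D_mult_D D_one generators_Sp4)
qed

lemma Sz_subgroup: "subgroup (Sz n) (Sp4 :: 'a mat monoid)"
  unfolding Sz_def
  by (rule group.generate_is_subgroup[OF Sp4_group]) (auto simp: generators_Sp4)

lemma D_in_Sz: "l \<noteq> 0 \<Longrightarrow> D l \<in> Sz n"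
  unfolding Sz_def by (intro generate.incl) auto

lemma T_in_Sz: "T a b \<in> Sz n"
  unfolding Sz_def by (intro generate.incl) auto

text \<open>The generating set is closed under inverses by \<open>inv_generators\<close>, so closure
  of the cells under products suffices.\<close>

lemma Sz_bruhat:
  assumes "X \<in> (Sz n :: 'a mat set)"
  shows "X \<in> cell \<union> big_cell"
  using assms unfolding Sz_def
proof (induction rule: generate.induct)
  case one
  then show ?case using cells_T_D(2)[of 1] by (simp add: D_one)
next
  case (incl h)
  then show ?case using cells_T_D cells_T_D(2)[of 1] W_mult_bruhat[of "D 1"] by (auto simp: D_one)
next
  case (inv h)
  then show ?case using cells_T_D cells_T_D(2)[of 1] W_mult_bruhat[of "D 1"] by (auto simp: inv_generators D_one)
next
  case (eng h1 h2)
  then show ?case using bruhat_mult by simp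
qed

lemma big_cell_index: "(T a b * (D l * (W * T c d))) $$ (0,3) = l * p l"
  unfolding T_rows D_rows sz_W_def rows4_mult by simp

text \<open>Elements of \<open>big_cell\<close> have a nonzero upper right entry and so move the
  line through e_4.\<close>

lemma Sz_pt_stab:
  assumes "X \<in> Sz n" "X \<in> pt_stab"
  obtains a b l where "l \<noteq> 0" "X = T a b * D l"
  using Sz_bruhat[OF assms(1)]
proof (cases rule: bruhat_cases)
  case (2 a b l c d)
  then have "X $$ (0,3) \<noteq> 0" by (simp only: big_cell_index) simp
  then show ?thesis using assms(2) by (simp add: pt_stab_def)
qed (use that in blast)

lemma T_D_pt_stab:
  assumes "l \<noteq> 0"
  shows "T a b * D l \<in> pt_stab" "(T a b * D l) $$ (3,3) = inverse (l * p l)"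
proof -
  interpret group "Sp4 :: 'a mat monoid" by (rule Sp4_group)
  have "T a b * D l \<in> carrier Sp4"
    using m_closed[OF generators_Sp4(1) generators_Sp4(2)[OF assms]] by simp
  then show "T a b * D l \<in> pt_stab" "(T a b * D l) $$ (3,3) = inverse (l * p l)"
    unfolding pt_stab_def T_rows D_rows rows4_mult by simp_all
qed

text \<open>The transvection that sends e_4 to e_1 + e_4; in characteristic two it is an
  involution.\<close>

definition x0 :: "'a mat" where
  "x0 = mat_of_rows_list 4 [[1,0,0,1],[0,1,0,0],[0,0,1,0],[0,0,0,1]]"

lemma x0_Sp4: "x0 \<in> carrier Sp4"
  unfolding Sp4_def x0_def J4_rows by (simp add: rows4_mult rows4_transpose)

lemma x0_not_pt_stab: "x0 \<notin> pt_stab"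
proof
  assume "x0 \<in> pt_stab"
  then have "x0 $$ (0,3) = 0" by (simp add: pt_stab_def)
  then show False by (simp add: x0_def)
qed

lemma inv_x0: "inv\<^bsub>Sp4\<^esub> x0 = x0"
proof -
  interpret group "Sp4 :: 'a mat monoid" by (rule Sp4_group)
  have "x0 * x0 = 1\<^sub>m 4" unfolding x0_def rows4_mult one_mat4 by (rule rows4_eqI) simp_all
  then show ?thesis by (intro inv_equality) (simp_all add: x0_Sp4)
qed

text \<open>The condition says that \<open>T a b * D l\<close> fixes the line through e_1 + e_4. The
  middle coordinates force \<open>a\<close> and \<open>b\<close> to vanish, and the outer ones force
  \<open>s\<close> to be its own inverse, hence 1 in characteristic two.\<close>

lemma x0_stab_trivial:
  assumes l: "l \<noteq> 0" and stab: "x0 * (T a b * D l) * x0 \<in> pt_stab"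
  shows "T a b * D l = 1\<^sub>m 4"
proof -
  define s where "s = l * p l"
  have s: "s \<noteq> 0" "inverse l * p (inverse l) = inverse s" using l by (simp_all add: s_def)
  let ?X = "x0 * (T a b * D l) * x0"
  have "?X $$ (0,3) = 0" "?X $$ (1,3) = 0" "?X $$ (2,3) = 0"
    using stab by (auto simp: pt_stab_def)
  then have eqs: "(1 + N a b) * s + inverse s = 0" "a * s = 0" "b * s = 0"
    unfolding x0_def T_rows D_rows rows4_mult s_def[symmetric] s(2)
    by (simp_all add: N_def algebra_simps)
  then have ab: "a = 0" "b = 0" using s by simp_all
  with eqs(1) have "s = inverse s" by (simp add: N_def)
  then have "s * s = 1" using s(1) by (metis right_inverse)
  then have "(s + 1) * (s + 1) = 0" by (simp add: algebra_simps)
  then have "s = 1" by simp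
  \<comment> \<open>Since \<open>s = 1\<close>, both \<open>l * p l\<close> and its image under
    \<open>t\<close> are 1; the two differ by the factor \<open>p l\<close>.\<close>
  moreover have "t s = l * (p l * p l)" by (simp add: s_def p_sq mult.commute)
  ultimately have "p l = 1" by (metis s_def mult.assoc mult_1 t_1)
  with \<open>s = 1\<close> have "l = 1" by (simp add: s_def)
  with ab show ?thesis by (simp add: T_zero D_one)
qed

end

section \<open>Verification of the hypotheses of \<open>not_strong_gelfand_pair\<close>\<close>

theorem theorem5p5:
  fixes n :: nat
  assumes "n > 0"
    and "card (UNIV :: ('a::{field, finite}) set) = 2 ^ (2 * n + 1)"
  shows "\<not> strong_gelfand_pair (Sp4 :: 'a mat monoid) (Sz n)"
proof -
  interpret suzuki_field n "TYPE('a)" by unfold_locales (rule assms(2))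
  have "(2::nat) ^ 3 \<le> 2 ^ (2 * n + 1)" using assms(1) by (intro power_increasing) auto
  then have card: "card (UNIV :: 'a set) > 3" using assms(2) by simp
  obtain \<nu> :: "'a \<Rightarrow> complex" and s where
    \<nu>_mult: "\<And>x y. x \<noteq> 0 \<Longrightarrow> y \<noteq> 0 \<Longrightarrow> \<nu> (x * y) = \<nu> x * \<nu> y" and
    \<nu>_unit: "\<And>x. x \<noteq> 0 \<Longrightarrow> \<nu> x * cnj (\<nu> x) = 1" and
    s: "s \<noteq> 0" "\<nu> s * \<nu> s \<noteq> 1"
    using finite_field_character[OF card] by blast
  have "\<nu> 1 = 1" using \<nu>_mult[of 1 1] \<nu>_unit[of 1] by auto
  then have \<nu>_inv: "\<nu> s * \<nu> (inverse s) = 1" using \<nu>_mult[of s "inverse s"] s by simp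
  \<comment> \<open>One inequality for each alternative in \<open>Sp4_mackey\<close>; both follow
    from \<open>\<nu> s * \<nu> s \<noteq> 1\<close>.\<close>
  have \<nu>_s: "\<nu> s \<noteq> \<nu> (inverse s)" "\<nu> s \<noteq> 1" using s \<nu>_inv by auto
  define \<mu> where "\<mu> A = \<nu> (A $$ (3,3))" for A
  interpret Sp: group "Sp4 :: 'a mat monoid" by (rule Sp4_group)
  interpret M: monomial "Sp4 :: 'a mat monoid" pt_stab \<mu>
  proof (intro monomial.intro monomial_axioms.intro Sp4_group Sp4_finite pt_stab_subgroup)
    fix A B :: "'a mat" assume "A \<in> pt_stab" "B \<in> pt_stab"
    then show "\<mu> (A \<otimes>\<^bsub>Sp4\<^esub> B) = \<mu> A * \<mu> B"
      using pt_stab_mult_index[of A B 3] Sp4_carrier_mat[OF pt_stab_Sp4[of A]]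
      by (simp add: \<mu>_def \<nu>_mult pt_stab_nonzero del: index_mult_mat)
  qed (simp add: \<mu>_def \<nu>_unit pt_stab_nonzero)
  show ?thesis
  proof (rule M.not_strong_gelfand_pair[OF Sz_subgroup, where ?x0.0 = x0])
    fix g :: "'a mat" assume "g \<in> carrier Sp4" "g \<notin> pt_stab"
    from Sp4_mackey[OF this s(1)] obtain k k' where "k \<in> pt_stab" "k' \<in> pt_stab" "k * g = g * k'"
      "k $$ (3,3) = s \<and> k' $$ (3,3) = inverse s \<or> k $$ (3,3) = 1 \<and> k' $$ (3,3) = s" by blast
    moreover from this have "\<mu> k \<noteq> \<mu> k'" using \<nu>_s \<open>\<nu> 1 = 1\<close> by (auto simp: \<mu>_def)
    ultimately show "\<exists>k\<in>pt_stab. \<exists>k'\<in>pt_stab. k \<otimes>\<^bsub>Sp4\<^esub> g = g \<otimes>\<^bsub>Sp4\<^esub> k' \<and> \<mu> k \<noteq> \<mu> k'" by auto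
  next
    fix g :: "'a mat" assume g: "g \<in> Sz n" "g \<notin> pt_stab"
    obtain a b l c d where l: "l \<noteq> 0" and geq: "g = T a b * (D l * (W * T c d))"
      using Sz_bruhat[OF g(1)] g(2) by (cases rule: bruhat_cases) (auto dest: T_D_pt_stab(1))
    \<comment> \<open>Chosen to solve \<open>m * p m = s\<close>, so that
      \<open>D (inverse m)\<close> and \<open>D m\<close> act on e_4 by \<open>s\<close> and
      \<open>inverse s\<close>.\<close>
    define m where "m = s * s * inverse (t s)"
    have "m * p m = s * (t s * inverse (t s)) * (s * inverse s)"
      by (simp add: m_def p_sq mult_ac)
    then have m: "m \<noteq> 0" "m * p m = s" using s(1) by (simp_all add: m_def)
    let ?u = "T a b * D l" and ?v = "T c d"
    have u: "?u \<in> pt_stab" "?u \<in> Sz n"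
      using T_D_pt_stab[OF l] subgroup.m_closed[OF Sz_subgroup T_in_Sz D_in_Sz[OF l]] by simp_all
    have v: "?v \<in> pt_stab" using T_D_pt_stab(1)[of 1 c d] by (simp add: D_one)
    have Dm: "D x \<in> pt_stab" "D x $$ (3,3) = inverse (x * p x)" if "x \<noteq> 0" for x
      using T_D_pt_stab[OF that, of 0 0] by (simp_all add: T_zero)
    have conj_closed: "y \<otimes>\<^bsub>Sp4\<^esub> x \<otimes>\<^bsub>Sp4\<^esub> inv\<^bsub>Sp4\<^esub> y \<in> pt_stab \<inter> Sz n"
      if "x \<in> pt_stab" "x \<in> Sz n" "y \<in> pt_stab" "y \<in> Sz n" for x y :: "'a mat"
      by (intro IntI M.K_closed subgroup.m_closed[OF Sz_subgroup]
        subgroup.m_inv_closed[OF Sz_subgroup] that)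
    have \<mu>_conj: "\<mu> (y \<otimes>\<^bsub>Sp4\<^esub> x \<otimes>\<^bsub>Sp4\<^esub> inv\<^bsub>Sp4\<^esub> y) = \<mu> x"
      if "x \<in> pt_stab" "y \<in> pt_stab" for x y :: "'a mat"
    proof -
      have "\<mu> (y \<otimes>\<^bsub>Sp4\<^esub> x \<otimes>\<^bsub>Sp4\<^esub> inv\<^bsub>Sp4\<^esub> y) = \<mu> y * \<mu> x * \<mu> (inv\<^bsub>Sp4\<^esub> y)"
        using that M.K_closed by (simp only: M.mu_mult)
      then show ?thesis using M.mu_inv[OF that(2)] by (simp add: algebra_simps)
    qed
    \<comment> \<open>Because \<open>D (inverse m) * W = W * D m\<close>, conjugating the two
      diagonal matrices by the outer factors of \<open>g\<close> makes \<open>k\<close> and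
      \<open>k'\<close> correspond under \<open>g\<close>. Conjugation inside \<open>pt_stab\<close>
      leaves \<open>\<mu>\<close> unchanged.\<close>
    define k where "k = ?u \<otimes>\<^bsub>Sp4\<^esub> D (inverse m) \<otimes>\<^bsub>Sp4\<^esub> inv\<^bsub>Sp4\<^esub> ?u"
    define k' where "k' = inv\<^bsub>Sp4\<^esub> ?v \<otimes>\<^bsub>Sp4\<^esub> D m \<otimes>\<^bsub>Sp4\<^esub> inv\<^bsub>Sp4\<^esub> (inv\<^bsub>Sp4\<^esub> ?v)"
    have iv: "inv\<^bsub>Sp4\<^esub> ?v \<in> pt_stab" "inv\<^bsub>Sp4\<^esub> ?v \<in> Sz n"
      using v M.K_closed subgroup.m_inv_closed[OF Sz_subgroup T_in_Sz] by auto
    have "k \<in> pt_stab \<inter> Sz n" unfolding k_def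
      using u Dm m D_in_Sz by (intro conj_closed) auto
    moreover have "k' \<in> pt_stab \<inter> Sz n" unfolding k'_def
      using iv Dm m D_in_Sz by (intro conj_closed) auto
    moreover have "k \<otimes>\<^bsub>Sp4\<^esub> g = g \<otimes>\<^bsub>Sp4\<^esub> k'"
    proof -
      have car: "?u \<in> carrier Sp4" "?v \<in> carrier Sp4" "W \<in> carrier Sp4" "D m \<in> carrier Sp4"
        "D (inverse m) \<in> carrier Sp4"
        using u v pt_stab_Sp4 generators_Sp4 m by auto
      have "g = ?u \<otimes>\<^bsub>Sp4\<^esub> (W \<otimes>\<^bsub>Sp4\<^esub> ?v)" by (simp add: geq mult_assoc4)
      moreover have "D (inverse m) \<otimes>\<^bsub>Sp4\<^esub> (W \<otimes>\<^bsub>Sp4\<^esub> ?v) = W \<otimes>\<^bsub>Sp4\<^esub> (D m \<otimes>\<^bsub>Sp4\<^esub> ?v)"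
        by (simp add: assoc_rewrites)
      ultimately show ?thesis
        using car unfolding k_def k'_def by (simp add: Sp.m_assoc del: Sp4_simps)
    qed
    moreover have "\<mu> k \<noteq> \<mu> k'"
    proof -
      have "\<mu> k = \<mu> (D (inverse m))" unfolding k_def using u Dm m by (intro \<mu>_conj) auto
      moreover have "\<mu> k' = \<mu> (D m)" unfolding k'_def using iv Dm m by (intro \<mu>_conj) auto
      moreover have "inverse (inverse m * p (inverse m)) = s" using m by simp
      ultimately show ?thesis using \<nu>_s Dm(2)[of m] Dm(2)[of "inverse m"] m by (simp add: \<mu>_def)
    qed
    ultimately show "\<exists>k\<in>pt_stab \<inter> Sz n. \<exists>k'\<in>pt_stab \<inter> Sz n. k \<otimes>\<^bsub>Sp4\<^esub> g = g \<otimes>\<^bsub>Sp4\<^esub> k' \<and> \<mu> k \<noteq> \<mu> k'"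
      by blast
  next
    show "x0 \<in> carrier Sp4" by (rule x0_Sp4)
    show "x0 \<notin> pt_stab" by (rule x0_not_pt_stab)
    fix b :: "'a mat"
    assume b: "b \<in> pt_stab \<inter> Sz n" "inv\<^bsub>Sp4\<^esub> x0 \<otimes>\<^bsub>Sp4\<^esub> b \<otimes>\<^bsub>Sp4\<^esub> x0 \<in> pt_stab"
    then obtain x y l where "l \<noteq> 0" "b = T x y * D l" by (elim IntE Sz_pt_stab)
    with b(2) show "b = \<one>\<^bsub>Sp4\<^esub>" using x0_stab_trivial[of l x y] by (simp add: inv_x0)
  qed
qed

end
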